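(* For every ring $R$ and every cardinal $\lambda\geq\operatorname{card}(R)+\aleph_0$, $\mathscr{L}_R$ and $\mathscr{L}_{R,\lambda}$ are lattices whose bottom element is the submodule relation.
   Context: Rings are associative with identity, modules are left modules, $\operatorname{card}(R)$ is the cardinality of $R$. $R\text{-}\mathrm{Mod}$ is the class of all $R$-modules, viewed as structures in the language $\{0,+,-\}\cup\{r\cdot\mid r\in R\}$. $A\leq_\oplus B$ means $A$ is a direct summand of $B$. AEC: a pair $\mathcal K=(\mathbf K,\preccurlyeq)$, with $\mathbf K$ a class of $L$-structures and $\preccurlyeq$ a binary relation on $\mathbf K$, such that: (i) $\mathbf K$ and $\preccurlyeq$ are closed under isomorphisms; (ii) $A\preccurlyeq B$ implies $A$ is a substructure of $B$; (iii) $\preccurlyeq$ is a partial order; (iv) if $(A_i)_{i<\delta}$ ($\delta$ limit) is an increasing continuous $\preccurlyeq$-chain in $\mathbf K$, then $A=\bigcup_{i<\delta}A_i\in\mathbf K$, $A_j\preccurlyeq A$ for all $j<\delta$, and if $A_i\preccurlyeq B$ for all $i<\delta$ then $A\preccurlyeq B$; (v) if $A\preccurlyeq C$, $B\preccurlyeq C$ and $A$ is a substructure of $B$ then $A\preccurlyeq B$; (vi) there is a cardinal $\lambda\geq|L|+\aleph_0$ such that for all $B\in\mathbf K$, $X\subseteq B$ there is $A\in\mathbf K$ with $X\subseteq A\preccurlyeq B$ and $|A|\leq|X|+\lambda$; the least such $\lambda$ is $\mathrm{LS}(\mathcal K)$. For $\lambda\geq\operatorname{card}(R)+\aleph_0$,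 $\mathscr{L}_{R,\lambda}$ is the class of all binary relations $\preccurlyeq$ on $R\text{-}\mathrm{Mod}$ such that $(R\text{-}\mathrm{Mod},\preccurlyeq)$ is an AEC, $\mathrm{LS}(R\text{-}\mathrm{Mod},\preccurlyeq)\leq\lambda$, and $A\leq_\oplus B$ implies $A\preccurlyeq B$. $\mathscr{L}_R=\bigcup_{\lambda\geq\operatorname{card}(R)+\aleph_0}\mathscr{L}_{R,\lambda}$. Both are ordered by reverse inclusion (stronger relations are higher). *)

theory Defs
  imports "HOL-Algebra.Ring"
begin

unbundle cardinal_syntax

text \<open>
  The set-theoretic universe is represented by a type \<open>'u\<close> whose cardinality is regular and
  uncountable. Sets are the subsets of \<open>'u\<close> of cardinality less than that of \<open>'u\<close>
  (``small'' sets), cardinals are the cardinals below the one of \<open>'u\<close>, ordinals are the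
  order types of small well-orders, and classes are arbitrary sets of structures with
  small domain. If the cardinality of \<open>'u\<close> is strongly inaccessible, these are,
  up to isomorphism, the sets and classes of a Grothendieck universe; strong inaccessibility is
  not required, which makes the results below more general.
\<close>

definition small :: "'u set \<Rightarrow> bool" where
  "small X \<longleftrightarrow> |X| <o |UNIV :: 'u set|"

definition small_cardinal :: "'u rel \<Rightarrow> bool" where
  "small_cardinal \<kappa> \<longleftrightarrow> Card_order \<kappa> \<and> \<kappa> <o |UNIV :: 'u set|"

section \<open>Languages and structures\<close>

record 's language =
  fsyms :: "'s set"
  rsyms :: "'s set"
  arity :: "'s \<Rightarrow> nat"

record ('s, 'u) struct =
  univ :: "'u set"
  fn :: "'s \<Rightarrow> 'u list \<Rightarrow> 'u"
  rl :: "'s \<Rightarrow> 'u list \<Rightarrow> bool"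

definition lang_card :: "'s language \<Rightarrow> 's rel" where
  "lang_card L = |fsyms L \<union> rsyms L|"

definition args :: "'s language \<Rightarrow> ('s, 'u) struct \<Rightarrow> 's \<Rightarrow> 'u list set" where
  "args L M s = {xs. length xs = arity L s \<and> set xs \<subseteq> univ M}"

text \<open>
  The interpretations take a fixed value outside their intended domains, so that equality of
  records is equality of structures.
\<close>

definition structures :: "'s language \<Rightarrow> ('s, 'u) struct set" where
  "structures L = {M.
     univ M \<noteq> {} \<and> small (univ M) \<and>
     (\<forall>f xs. f \<in> fsyms L \<and> xs \<in> args L M f \<longrightarrow> fn M f xs \<in> univ M) \<and>
     (\<forall>f xs. \<not> (f \<in> fsyms L \<and> xs \<in> args L M f) \<longrightarrow> fn M f xs = undefined) \<and>
     (\<forall>p xs. rl M p xs \<longrightarrow> p \<in> rsyms L \<and> xs \<in> args L M p)}"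

definition substructure :: "'s language \<Rightarrow> ('s, 'u) struct \<Rightarrow> ('s, 'u) struct \<Rightarrow> bool" where
  "substructure L A B \<longleftrightarrow>
     A \<in> structures L \<and> B \<in> structures L \<and> univ A \<subseteq> univ B \<and>
     (\<forall>f\<in>fsyms L. \<forall>xs\<in>args L A f. fn A f xs = fn B f xs) \<and>
     (\<forall>p\<in>rsyms L. \<forall>xs\<in>args L A p. rl A p xs \<longleftrightarrow> rl B p xs)"

definition isomorphism ::
  "'s language \<Rightarrow> ('u \<Rightarrow> 'u) \<Rightarrow> ('s, 'u) struct \<Rightarrow> ('s, 'u) struct \<Rightarrow> bool" where
  "isomorphism L h A B \<longleftrightarrow>
     A \<in> structures L \<and> B \<in> structures L \<and> bij_betw h (univ A) (univ B) \<and>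
     (\<forall>f\<in>fsyms L. \<forall>xs\<in>args L A f. h (fn A f xs) = fn B f (map h xs)) \<and>
     (\<forall>p\<in>rsyms L. \<forall>xs\<in>args L A p. rl A p xs \<longleftrightarrow> rl B p (map h xs))"

text \<open>
  The union of a family that is directed under the substructure relation: since
  tuples are finite, each one lies in some member, and any two members containing it agree on it.
\<close>

definition struct_union ::
  "'s language \<Rightarrow> 'i set \<Rightarrow> ('i \<Rightarrow> ('s, 'u) struct) \<Rightarrow> ('s, 'u) struct" where
  "struct_union L I A =
     \<lparr> univ = (\<Union>i\<in>I. univ (A i)),
       fn = (\<lambda>f xs. if f \<in> fsyms L \<and> (\<exists>i\<in>I. xs \<in> args L (A i) f)
                    then fn (A (SOME i. i \<in> I \<and> xs \<in> args L (A i) f)) f xs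
                    else undefined),
       rl = (\<lambda>p xs. \<exists>i\<in>I. rl (A i) p xs) \<rparr>"

section \<open>Abstract elementary classes\<close>

definition limit_order :: "'i rel \<Rightarrow> bool" where
  "limit_order r \<longleftrightarrow> Well_order r \<and> Field r \<noteq> {} \<and>
     (\<forall>i\<in>Field r. \<exists>j\<in>Field r. i \<noteq> j \<and> (i, j) \<in> r)"

text \<open>
  A chain indexed by the well-order \<open>r\<close>. An index \<open>i\<close> is a limit iff its set of
  strict predecessors \<open>underS r i\<close> is a limit order.
\<close>

definition continuous_chain ::
  "'s language \<Rightarrow> ('s, 'u) struct set \<Rightarrow> ('s, 'u) struct rel \<Rightarrow> 'i rel \<Rightarrow>
     ('i \<Rightarrow> ('s, 'u) struct) \<Rightarrow> bool" where
  "continuous_chain L K leK r A \<longleftrightarrow>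
     (\<forall>i\<in>Field r. A i \<in> K) \<and>
     (\<forall>i j. (i, j) \<in> r \<longrightarrow> (A i, A j) \<in> leK) \<and>
     (\<forall>i\<in>Field r. limit_order (Restr r (underS r i)) \<longrightarrow>
        A i = struct_union L (underS r i) A)"

definition LS_property ::
  "'s language \<Rightarrow> ('s, 'u) struct set \<Rightarrow> ('s, 'u) struct rel \<Rightarrow> 'u rel \<Rightarrow> bool" where
  "LS_property L K leK \<kappa> \<longleftrightarrow>
     small_cardinal \<kappa> \<and> lang_card L +c natLeq \<le>o \<kappa> \<and>
     (\<forall>B\<in>K. \<forall>X\<subseteq>univ B. \<exists>A\<in>K. X \<subseteq> univ A \<and> (A, B) \<in> leK \<and> |univ A| \<le>o |X| +c \<kappa>)"

text \<open>The least cardinal with \<open>LS_property\<close>, unique up to \<open>=o\<close>.\<close>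

definition LS_number ::
  "'s language \<Rightarrow> ('s, 'u) struct set \<Rightarrow> ('s, 'u) struct rel \<Rightarrow> 'u rel" where
  "LS_number L K leK =
     (SOME \<kappa>. LS_property L K leK \<kappa> \<and> (\<forall>\<nu>. LS_property L K leK \<nu> \<longrightarrow> \<kappa> \<le>o \<nu>))"

locale AEC =
  fixes L :: "'s language"
    and K :: "('s, 'u) struct set"
    and leK :: "('s, 'u) struct rel"
  assumes K_structures: "K \<subseteq> structures L"
    and iso_closed: "\<lbrakk>A \<in> K; isomorphism L h A B\<rbrakk> \<Longrightarrow> B \<in> K"
    and le_iso_closed:
      "\<lbrakk>(A, B) \<in> leK; isomorphism L h B B'; isomorphism L h A A'\<rbrakk> \<Longrightarrow> (A', B') \<in> leK"
    and le_substructure: "(A, B) \<in> leK \<Longrightarrow> substructure L A B"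
    and le_partial_order: "partial_order_on K leK"
    and chain_union:
      "\<lbrakk>limit_order (r :: 'u rel); small (Field r); continuous_chain L K leK r C\<rbrakk> \<Longrightarrow>
         struct_union L (Field r) C \<in> K \<and>
         (\<forall>j\<in>Field r. (C j, struct_union L (Field r) C) \<in> leK) \<and>
         (\<forall>B. (\<forall>i\<in>Field r. (C i, B) \<in> leK) \<longrightarrow> (struct_union L (Field r) C, B) \<in> leK)"
    and coherence: "\<lbrakk>(A, C') \<in> leK; (B, C') \<in> leK; substructure L A B\<rbrakk> \<Longrightarrow> (A, B) \<in> leK"
    and LS: "\<exists>\<kappa>. LS_property L K leK \<kappa>"

section \<open>Modules\<close>

datatype 'r mod_sym = Zero | Plus | Minus | Scal 'r

definition mod_lang :: "('r, 'b) ring_scheme \<Rightarrow> 'r mod_sym language" where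
  "mod_lang R =
     \<lparr> fsyms = {Zero, Plus, Minus} \<union> Scal ` carrier R,
       rsyms = {},
       arity = (\<lambda>s. case s of Zero \<Rightarrow> 0 | Plus \<Rightarrow> 2 | Minus \<Rightarrow> 1 | Scal _ \<Rightarrow> 1) \<rparr>"

abbreviation mzero :: "('r mod_sym, 'u) struct \<Rightarrow> 'u" where
  "mzero M \<equiv> fn M Zero []"

abbreviation mplus :: "('r mod_sym, 'u) struct \<Rightarrow> 'u \<Rightarrow> 'u \<Rightarrow> 'u" where
  "mplus M x y \<equiv> fn M Plus [x, y]"

abbreviation mminus :: "('r mod_sym, 'u) struct \<Rightarrow> 'u \<Rightarrow> 'u" where
  "mminus M x \<equiv> fn M Minus [x]"

abbreviation mscal :: "('r mod_sym, 'u) struct \<Rightarrow> 'r \<Rightarrow> 'u \<Rightarrow> 'u" where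
  "mscal M r x \<equiv> fn M (Scal r) [x]"

text \<open>
  The library's locale \<open>module\<close> requires a commutative ring, hence a separate definition of
  (unital) left modules over a possibly noncommutative ring.
\<close>

definition RMod :: "('r, 'b) ring_scheme \<Rightarrow> ('r mod_sym, 'u) struct set" where
  "RMod R = {M \<in> structures (mod_lang R).
     comm_group \<lparr> carrier = univ M, mult = mplus M, one = mzero M \<rparr> \<and>
     (\<forall>x\<in>univ M. mplus M x (mminus M x) = mzero M) \<and>
     (\<forall>r\<in>carrier R. \<forall>x\<in>univ M. \<forall>y\<in>univ M.
        mscal M r (mplus M x y) = mplus M (mscal M r x) (mscal M r y)) \<and>
     (\<forall>r\<in>carrier R. \<forall>s\<in>carrier R. \<forall>x\<in>univ M.
        mscal M (r \<oplus>\<^bsub>R\<^esub> s) x = mplus M (mscal M r x) (mscal M s x)) \<and>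
     (\<forall>r\<in>carrier R. \<forall>s\<in>carrier R. \<forall>x\<in>univ M.
        mscal M (r \<otimes>\<^bsub>R\<^esub> s) x = mscal M r (mscal M s x)) \<and>
     (\<forall>x\<in>univ M. mscal M \<one>\<^bsub>R\<^esub> x = x)}"

definition submodule_rel :: "('r, 'b) ring_scheme \<Rightarrow> ('r mod_sym, 'u) struct rel" where
  "submodule_rel R = {(A, B). A \<in> RMod R \<and> B \<in> RMod R \<and> substructure (mod_lang R) A B}"

definition direct_summand ::
  "('r, 'b) ring_scheme \<Rightarrow> ('r mod_sym, 'u) struct \<Rightarrow> ('r mod_sym, 'u) struct \<Rightarrow> bool" where
  "direct_summand R A B \<longleftrightarrow>
     (A, B) \<in> submodule_rel R \<and>
     (\<exists>C. (C, B) \<in> submodule_rel R \<and> univ A \<inter> univ C = {mzero B} \<and>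
        (\<forall>b\<in>univ B. \<exists>a\<in>univ A. \<exists>c\<in>univ C. b = mplus B a c))"

section \<open>The lattices of AEC relations\<close>

definition admissible_cardinal :: "('r, 'b) ring_scheme \<Rightarrow> 'u rel \<Rightarrow> bool" where
  "admissible_cardinal R \<kappa> \<longleftrightarrow> small_cardinal \<kappa> \<and> |carrier R| +c natLeq \<le>o \<kappa>"

definition aec_rels_bounded ::
  "('r, 'b) ring_scheme \<Rightarrow> 'u rel \<Rightarrow> ('r mod_sym, 'u) struct rel set" where
  "aec_rels_bounded R \<kappa> =
     {leK. AEC (mod_lang R) (RMod R) leK \<and>
           LS_number (mod_lang R) (RMod R) leK \<le>o \<kappa> \<and>
           (\<forall>A B. direct_summand R A B \<longrightarrow> (A, B) \<in> leK)}"

definition aec_rels :: "('r, 'b) ring_scheme \<Rightarrow> ('r mod_sym, 'u) struct rel set" where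
  "aec_rels R = (\<Union>\<kappa>\<in>{\<kappa>. admissible_cardinal R \<kappa>}. aec_rels_bounded R \<kappa>)"

definition reverse_inclusion :: "'a set set \<Rightarrow> 'a set gorder" where
  "reverse_inclusion S = \<lparr> carrier = S, eq = (=), le = (\<lambda>x y. y \<subseteq> x) \<rparr>"

end

theory Submission
  imports Defs
begin

text \<open>
  In the reverse order the two lattice operations have different origins.

  The join of two relations is their intersection. All AEC axioms except the existence of a
  Loewenheim-Skolem cardinal pass to intersections (\<open>AEC_Inter\<close>). For two relations the
  remaining axiom holds with the same cardinal: alternate between hulls for the two relations; by
  coherence each of the two subsequences of hulls is a chain for its relation, and both chains have
  the same union (\<open>LS_property_Int\<close>).

  The meet of two relations is the intersection of all members of the class that contain both.
  This family may be large, so alternating hulls would not give a bound. But a hull for a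
  relation is also a hull for every weaker relation, and the intersection is weaker than the two
  given ones, so it inherits their cardinal (\<open>LS_property_mono_rel\<close>,
  \<open>aec_rels_bounded_Inter\<close>).

  The meet requires that the family be nonempty, which the submodule relation provides. Every
  AEC relation refines it, so it is the bottom element once it is an AEC with all admissible
  cardinals as Loewenheim-Skolem cardinals. Modules are axiomatised by universal equations, so
  they are closed under substructures, isomorphic copies and unions of chains, and closing a set under
  the finitary operations gives small submodules (\<open>substructure_hull\<close>).

  Since cardinals are well-ordered, the bound on the Loewenheim-Skolem number in the definition of the
  classes amounts to the Loewenheim-Skolem property at the bound itself
  (\<open>LS_number_le_iff\<close>).
\<close>

section \<open>Substructures\<close>

lemma structures_fn_closed:
  "\<lbrakk>M \<in> structures L; f \<in> fsyms L; xs \<in> args L M f\<rbrakk> \<Longrightarrow> fn M f xs \<in> univ M"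
  by (simp add: structures_def)

lemma structures_nonempty: "M \<in> structures L \<Longrightarrow> univ M \<noteq> {}"
  by (simp add: structures_def)

lemma args_mono: "univ A \<subseteq> univ B \<Longrightarrow> xs \<in> args L A f \<Longrightarrow> xs \<in> args L B f"
  by (auto simp: args_def)

lemma substructure_univ: "substructure L A B \<Longrightarrow> univ A \<subseteq> univ B"
  by (simp add: substructure_def)

lemma substructure_fn:
  "\<lbrakk>substructure L A B; f \<in> fsyms L; xs \<in> args L A f\<rbrakk> \<Longrightarrow> fn A f xs = fn B f xs"
  by (simp add: substructure_def)

lemma substructure_rl:
  "\<lbrakk>substructure L A B; p \<in> rsyms L; xs \<in> args L A p\<rbrakk> \<Longrightarrow> rl A p xs \<longleftrightarrow> rl B p xs"
  by (simp add: substructure_def)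

lemma substructure_refl: "A \<in> structures L \<Longrightarrow> substructure L A A"
  by (simp add: substructure_def)

lemma substructure_structures: "substructure L A B \<Longrightarrow> A \<in> structures L \<and> B \<in> structures L"
  by (simp add: substructure_def)

lemma substructureI:
  assumes "A \<in> structures L" "B \<in> structures L" "univ A \<subseteq> univ B"
    and "\<And>f xs. \<lbrakk>f \<in> fsyms L; xs \<in> args L A f\<rbrakk> \<Longrightarrow> fn A f xs = fn B f xs"
    and "\<And>p xs. \<lbrakk>p \<in> rsyms L; xs \<in> args L A p\<rbrakk> \<Longrightarrow> rl A p xs \<longleftrightarrow> rl B p xs"
  shows "substructure L A B"
  using assms by (simp add: substructure_def)

lemma substructure_trans:
  assumes AB: "substructure L A B" and BC: "substructure L B C"
  shows "substructure L A C"
proof (rule substructureI)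
  note sub = substructure_univ[OF AB]
  show "univ A \<subseteq> univ C" using sub substructure_univ[OF BC] by (rule subset_trans)
  show "fn A f xs = fn C f xs" if "f \<in> fsyms L" "xs \<in> args L A f" for f xs
    using substructure_fn[OF AB that] substructure_fn[OF BC that(1) args_mono[OF sub that(2)]]
    by simp
  show "rl A p xs \<longleftrightarrow> rl C p xs" if "p \<in> rsyms L" "xs \<in> args L A p" for p xs
    using substructure_rl[OF AB that] substructure_rl[OF BC that(1) args_mono[OF sub that(2)]]
    by simp
qed (use substructure_structures[OF AB] substructure_structures[OF BC] in blast)+

lemma substructure_of_common_extension:
  assumes AC: "substructure L A C" and BC: "substructure L B C" and sub: "univ A \<subseteq> univ B"
  shows "substructure L A B"
proof (rule substructureI)
  show "fn A f xs = fn B f xs" if "f \<in> fsyms L" "xs \<in> args L A f" for f xs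
    using substructure_fn[OF AC that] substructure_fn[OF BC that(1) args_mono[OF sub that(2)]]
    by simp
  show "rl A p xs \<longleftrightarrow> rl B p xs" if "p \<in> rsyms L" "xs \<in> args L A p" for p xs
    using substructure_rl[OF AC that] substructure_rl[OF BC that(1) args_mono[OF sub that(2)]]
    by simp
qed (use substructure_structures[OF AC] substructure_structures[OF BC] sub in blast)+

lemma structures_fn_undefined:
  "\<lbrakk>M \<in> structures L; \<not> (f \<in> fsyms L \<and> xs \<in> args L M f)\<rbrakk> \<Longrightarrow> fn M f xs = undefined"
  by (simp add: structures_def)

lemma structures_rl_args: "\<lbrakk>M \<in> structures L; rl M p xs\<rbrakk> \<Longrightarrow> p \<in> rsyms L \<and> xs \<in> args L M p"
  by (simp add: structures_def)

text \<open>
  Inside one structure a substructure is determined by its universe: on tuples from the universe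
  the ambient structure prescribes the interpretations, and off them their values are conventional.
  This is what identifies the unions of two interleaved chains that carry different relations.
\<close>

lemma substructure_eqI:
  assumes A: "substructure L A C" and B: "substructure L B C" and u: "univ A = univ B"
  shows "A = B"
proof -
  have args: "args L A s = args L B s" for s
    by (simp add: args_def u)
  note str = substructure_structures[OF A, THEN conjunct1] substructure_structures[OF B, THEN conjunct1]
  have "fn A f xs = fn B f xs" for f xs
  proof (cases "f \<in> fsyms L \<and> xs \<in> args L B f")
    case True
    then show ?thesis using substructure_fn[OF A] substructure_fn[OF B] by (simp add: args)
  next
    case False
    then show ?thesis using str by (metis structures_fn_undefined args)
  qed
  moreover have "rl A p xs = rl B p xs" for p xs
  proof (cases "p \<in> rsyms L \<and> xs \<in> args L B p")
    case True
    then show ?thesis using substructure_rl[OF A] substructure_rl[OF B] by (simp add: args)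
  next
    case False
    then show ?thesis using str by (metis structures_rl_args args)
  qed
  ultimately show ?thesis
    using u by (intro struct.equality ext) simp_all
qed

lemma substructure_antisym: "\<lbrakk>substructure L A B; substructure L B A\<rbrakk> \<Longrightarrow> A = B"
  by (rule substructure_eqI[of L A B B])
    (auto dest: substructure_univ intro: substructure_refl simp: substructure_def)

lemma args_isomorphic_image:
  assumes "h ` univ A = univ B" "ys \<in> args L B s"
  obtains xs where "xs \<in> args L A s" "ys = map h xs"
proof -
  have "set ys \<subseteq> h ` univ A" using assms by (auto simp: args_def)
  then have "ys \<in> lists (h ` univ A)" by auto
  then have "ys \<in> map h ` lists (univ A)" by (simp add: lists_image)
  then obtain xs where "xs \<in> lists (univ A)" "ys = map h xs" by blast
  with assms that show ?thesis by (auto simp: args_def)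
qed

text \<open>
  The same map \<open>h\<close> restricts to both isomorphisms, so it carries the agreement of
  \<open>A\<close> and \<open>B\<close> over to their images.
\<close>

lemma substructure_isomorphic:
  assumes AB: "substructure L A B" and B: "isomorphism L h B B'" and A: "isomorphism L h A A'"
  shows "substructure L A' B'"
proof -
  have im: "h ` univ A = univ A'" "h ` univ B = univ B'"
    using A B by (auto simp: isomorphism_def bij_betw_def)
  have sub: "univ A \<subseteq> univ B" by (rule substructure_univ[OF AB])
  have "fn A' f ys = fn B' f ys" if f: "f \<in> fsyms L" and ys: "ys \<in> args L A' f" for f ys
  proof -
    obtain xs where xs: "xs \<in> args L A f" "ys = map h xs"
      using args_isomorphic_image[OF im(1) ys] .
    have "fn A' f ys = h (fn A f xs)" using A f xs by (simp add: isomorphism_def)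
    also have "\<dots> = h (fn B f xs)" using substructure_fn[OF AB f xs(1)] by simp
    also have "\<dots> = fn B' f ys" using B f xs args_mono[OF sub xs(1)] by (simp add: isomorphism_def)
    finally show ?thesis .
  qed
  moreover have "rl A' p ys \<longleftrightarrow> rl B' p ys"
    if p: "p \<in> rsyms L" and ys: "ys \<in> args L A' p" for p ys
  proof -
    obtain xs where xs: "xs \<in> args L A p" "ys = map h xs"
      using args_isomorphic_image[OF im(1) ys] .
    have "rl A' p ys \<longleftrightarrow> rl A p xs" using A p xs by (simp add: isomorphism_def)
    also have "\<dots> \<longleftrightarrow> rl B p xs" by (rule substructure_rl[OF AB p xs(1)])
    also have "\<dots> \<longleftrightarrow> rl B' p ys" using B p xs args_mono[OF sub xs(1)] by (simp add: isomorphism_def)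
    finally show ?thesis .
  qed
  moreover have "A' \<in> structures L" "B' \<in> structures L"
    using A B by (simp_all add: isomorphism_def)
  moreover have "univ A' \<subseteq> univ B'" using im sub by blast
  ultimately show ?thesis by (intro substructureI)
qed

lemma substructure_on_closed_subset:
  assumes B: "B \<in> structures L" and Y: "Y \<subseteq> univ B" "Y \<noteq> {}"
    and closed: "\<And>f xs. \<lbrakk>f \<in> fsyms L; length xs = arity L f; set xs \<subseteq> Y\<rbrakk> \<Longrightarrow> fn B f xs \<in> Y"
  shows "\<exists>A. substructure L A B \<and> univ A = Y"
proof -
  define arg where "arg = (\<lambda>s. {xs. length xs = arity L s \<and> set xs \<subseteq> Y})"
  define A :: "('a, 'b) struct" where
    "A = \<lparr> univ = Y,
       fn = (\<lambda>f xs. if f \<in> fsyms L \<and> xs \<in> arg f then fn B f xs else undefined),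
       rl = (\<lambda>p xs. p \<in> rsyms L \<and> xs \<in> arg p \<and> rl B p xs) \<rparr>"
  have A_sel: "univ A = Y"
    "fn A = (\<lambda>f xs. if f \<in> fsyms L \<and> xs \<in> arg f then fn B f xs else undefined)"
    "rl A = (\<lambda>p xs. p \<in> rsyms L \<and> xs \<in> arg p \<and> rl B p xs)"
    by (simp_all add: A_def)
  have args: "args L A s = arg s" for s
    by (simp add: args_def A_sel arg_def)
  have "small Y"
    using B Y(1) card_of_mono1 ordLeq_ordLess_trans
    unfolding structures_def small_def by blast
  then have A: "A \<in> structures L"
    using Y closed unfolding structures_def mem_Collect_eq args A_sel by (auto simp: arg_def)
  have "substructure L A B"
    by (rule substructureI[OF A B]) (unfold args, simp_all add: A_sel Y)
  then show ?thesis by (intro exI[of _ A]) (simp add: A_sel)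
qed

section \<open>Generated substructures\<close>

lemma card_of_finite_ordLeq_Cinfinite: "\<lbrakk>Cinfinite \<mu>; finite S\<rbrakk> \<Longrightarrow> |S| \<le>o \<mu>"
  using finite_ordLess_infinite[of "|S|" \<mu>] card_of_Well_order[of S]
  by (simp add: cinfinite_def Field_card_of card_order_on_well_order_on ordLess_imp_ordLeq)

lemma card_of_fixed_length_lists:
  assumes \<mu>: "Cinfinite \<mu>" and Y: "|Y| \<le>o \<mu>"
  shows "|{xs. length xs = n \<and> set xs \<subseteq> Y}| \<le>o \<mu>"
proof (induction n)
  case 0
  show ?case by (rule card_of_finite_ordLeq_Cinfinite[OF \<mu>]) simp
next
  case (Suc n)
  let ?N = "{xs. length xs = n \<and> set xs \<subseteq> Y}"
  have "{xs. length xs = Suc n \<and> set xs \<subseteq> Y} \<subseteq> (\<lambda>(x, xs). x # xs) ` (Y \<times> ?N)"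
    by (auto simp: length_Suc_conv image_iff)
  then have "|{xs. length xs = Suc n \<and> set xs \<subseteq> Y}| \<le>o |Y \<times> ?N|"
    by (rule ordLeq_transitive[OF card_of_mono1 card_of_image])
  moreover have "|Y \<times> ?N| \<le>o \<mu>"
    by (rule card_of_Times_ordLeq_infinite_Field[OF _ Y Suc]) (use \<mu> in \<open>simp_all add: cinfinite_def\<close>)
  ultimately show ?case by (rule ordLeq_transitive)
qed

lemma card_of_nat_ordLeq_Cinfinite: "Cinfinite \<mu> \<Longrightarrow> |UNIV :: nat set| \<le>o \<mu>"
  by (rule ordIso_ordLeq_trans[OF card_of_nat natLeq_ordLeq_cinfinite])

text \<open>
  Tuples are finite, so each one appears at some stage of an increasing family. For this reason closing
  a set under the operations is complete after \<open>\<omega>\<close> rounds, and the union of a chain of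
  structures carries a structure.
\<close>

lemma list_in_chain_union:
  assumes "I \<noteq> {}" and "\<And>i j. \<lbrakk>i \<in> I; j \<in> I\<rbrakk> \<Longrightarrow> U i \<subseteq> U j \<or> U j \<subseteq> U i"
    and "set xs \<subseteq> (\<Union>i\<in>I. U i)"
  shows "\<exists>i\<in>I. set xs \<subseteq> U i"
  using assms(3)
proof (induction xs)
  case Nil
  then show ?case using assms(1) by auto
next
  case (Cons x xs)
  then obtain i j where "i \<in> I" "j \<in> I" "x \<in> U i" "set xs \<subseteq> U j" by auto
  moreover have "U i \<subseteq> U j \<or> U j \<subseteq> U i" using \<open>i \<in> I\<close> \<open>j \<in> I\<close> by (rule assms(2))
  ultimately show ?case by (auto intro: bexI[of _ i] bexI[of _ j])
qed

text \<open>
  The downward Loewenheim argument without quantifiers: closing \<open>X\<close> under the operations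
  takes \<open>\<omega>\<close> rounds because operations are finitary, and no round produces more than
  \<open>\<mu>\<close> new elements.
\<close>

lemma substructure_hull:
  assumes B: "B \<in> structures L" and X: "X \<subseteq> univ B" "|X| \<le>o \<mu>"
    and \<mu>: "Cinfinite \<mu>" and L: "|fsyms L| \<le>o \<mu>"
  shows "\<exists>A. substructure L A B \<and> X \<subseteq> univ A \<and> |univ A| \<le>o \<mu>"
proof -
  obtain b where b: "b \<in> univ B" using B by (auto simp: structures_def)
  define step where "step = (\<lambda>Y. Y \<union> (\<Union>f\<in>fsyms L. fn B f ` {xs. length xs = arity L f \<and> set xs \<subseteq> Y}))"
  \<comment> \<open>the extra element keeps the hull nonempty when \<open>X\<close> is empty and there are no constants\<close>
  define Y where "Y = (\<lambda>n. (step ^^ n) (insert b X))"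
  have Suc: "Y (Suc n) = step (Y n)" for n by (simp add: Y_def)
  have Ysub: "Y n \<subseteq> univ B" for n
  proof (induction n)
    case 0
    then show ?case using b X by (simp add: Y_def)
  next
    case (Suc n)
    then show ?case
      unfolding \<open>Y (Suc n) = step (Y n)\<close> step_def
      by (auto intro!: structures_fn_closed[OF B] simp: args_def)
  qed
  have inf: "infinite (Field \<mu>)" using \<mu> by (simp add: cinfinite_def)
  have Ycard: "|Y n| \<le>o \<mu>" for n
  proof (induction n)
    case 0
    have "|{b}| \<le>o \<mu>" by (rule card_of_finite_ordLeq_Cinfinite[OF \<mu>]) simp
    then have "|{b} \<union> X| \<le>o \<mu>"
      using X \<mu> inf by (intro card_of_Un_ordLeq_infinite_Field) auto
    then show ?case by (simp add: Y_def)
  next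
    case (Suc n)
    have "|fn B f ` {xs. length xs = arity L f \<and> set xs \<subseteq> Y n}| \<le>o \<mu>" for f
      using card_of_image card_of_fixed_length_lists[OF \<mu> Suc] by (rule ordLeq_transitive)
    then show ?case
      unfolding \<open>Y (Suc n) = step (Y n)\<close> step_def using L Suc \<mu> inf
      by (intro card_of_Un_ordLeq_infinite_Field card_of_UNION_ordLeq_infinite_Field) auto
  qed
  have mono: "m \<le> n \<Longrightarrow> Y m \<subseteq> Y n" for m n
    by (rule lift_Suc_mono_le[of Y]) (auto simp: Suc step_def)
  obtain A where A: "substructure L A B" "univ A = (\<Union>n. Y n)"
  proof (atomize_elim, rule substructure_on_closed_subset[OF B])
    show "(\<Union>n. Y n) \<subseteq> univ B" using Ysub by blast
    have "b \<in> Y 0" by (simp add: Y_def)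
    then show "(\<Union>n. Y n) \<noteq> {}" by blast
    fix f xs
    assume f: "f \<in> fsyms L" and len: "length xs = arity L f" and xs: "set xs \<subseteq> (\<Union>n. Y n)"
    obtain n where "set xs \<subseteq> Y n"
      using list_in_chain_union[OF _ _ xs] mono nat_le_linear by blast
    then have "fn B f xs \<in> Y (Suc n)" unfolding Suc step_def using f len by blast
    then show "fn B f xs \<in> (\<Union>n. Y n)" by blast
  qed
  have "|\<Union>n. Y n| \<le>o \<mu>"
    using \<mu> inf Ycard card_of_nat_ordLeq_Cinfinite[OF \<mu>]
    by (intro card_of_UNION_ordLeq_infinite_Field) auto
  moreover have "X \<subseteq> (\<Union>n. Y n)"
  proof (rule subset_trans)
    show "X \<subseteq> Y 0" by (auto simp: Y_def)
  qed blast
  ultimately show ?thesis unfolding A(2)[symmetric] using A(1) by blast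
qed

section \<open>Unions of chains\<close>

lemma comparable_substructures_fn:
  assumes "substructure L A B \<or> substructure L B A" "f \<in> fsyms L"
    "xs \<in> args L A f" "xs \<in> args L B f"
  shows "fn A f xs = fn B f xs"
  using assms(1)
proof
  assume "substructure L A B"
  then show ?thesis using assms(2,3) by (rule substructure_fn)
next
  assume "substructure L B A"
  then show ?thesis using assms(2,4) by (rule substructure_fn[symmetric])
qed

lemma comparable_substructures_rl:
  assumes "substructure L A B \<or> substructure L B A" "p \<in> rsyms L"
    "xs \<in> args L A p" "xs \<in> args L B p"
  shows "rl A p xs \<longleftrightarrow> rl B p xs"
  using assms(1)
proof
  assume "substructure L A B"
  then show ?thesis using assms(2,3) by (rule substructure_rl)
next
  assume "substructure L B A"
  then show ?thesis using assms(2,4) by (rule substructure_rl[symmetric])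
qed

text \<open>
  Every tuple from the union lies in one member of the chain, so the interpretations at that tuple,
  and any comparison with a larger structure, are decided in that member. Comparability of the members
  makes the arbitrary choice in \<^const>\<open>struct_union\<close> irrelevant.
\<close>

lemma
  assumes I: "I \<noteq> {}"
    and chain: "\<And>i j. \<lbrakk>i \<in> I; j \<in> I\<rbrakk> \<Longrightarrow> substructure L (A i) (A j) \<or> substructure L (A j) (A i)"
    and small: "small (\<Union>i\<in>I. univ (A i))"
  shows struct_union_structure: "struct_union L I A \<in> structures L"
    and struct_union_upper: "\<And>j. j \<in> I \<Longrightarrow> substructure L (A j) (struct_union L I A)"
    and struct_union_least: "\<And>B. (\<And>i. i \<in> I \<Longrightarrow> substructure L (A i) B) \<Longrightarrow>
      substructure L (struct_union L I A) B"
proof -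
  let ?U = "struct_union L I A"
  have univ: "univ ?U = (\<Union>i\<in>I. univ (A i))" by (simp add: struct_union_def)
  have univ_chain: "univ (A i) \<subseteq> univ (A j) \<or> univ (A j) \<subseteq> univ (A i)" if "i \<in> I" "j \<in> I" for i j
    using chain[OF that] substructure_univ by blast
  have str: "A i \<in> structures L" if "i \<in> I" for i
    using chain[OF that that] substructure_structures by blast
  have locate: "\<exists>i\<in>I. xs \<in> args L (A i) s" if xs: "xs \<in> args L ?U s" for xs s
  proof -
    have "set xs \<subseteq> (\<Union>i\<in>I. univ (A i))" using xs by (simp add: args_def univ)
    then obtain i where "i \<in> I" "set xs \<subseteq> univ (A i)"
      using list_in_chain_union[of I "\<lambda>i. univ (A i)"] I univ_chain by blast
    then show ?thesis using xs by (auto simp: args_def)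
  qed
  have argsU: "xs \<in> args L ?U s" if "i \<in> I" "xs \<in> args L (A i) s" for i xs s
    using that by (auto simp: args_def univ)
  have fnU: "fn ?U f xs = fn (A i) f xs" if "f \<in> fsyms L" "i \<in> I" "xs \<in> args L (A i) f" for f xs i
  proof -
    define k where "k = (SOME i. i \<in> I \<and> xs \<in> args L (A i) f)"
    have k: "k \<in> I \<and> xs \<in> args L (A k) f"
      unfolding k_def by (rule someI[of _ i]) (use that in simp)
    have "fn ?U f xs = fn (A k) f xs" using that by (auto simp: struct_union_def k_def)
    also have "\<dots> = fn (A i) f xs"
      using k that by (intro comparable_substructures_fn[OF chain]) simp_all
    finally show ?thesis .
  qed
  have rlU: "rl ?U p xs \<longleftrightarrow> rl (A i) p xs"
    if p: "p \<in> rsyms L" and i: "i \<in> I" and xs: "xs \<in> args L (A i) p" for p xs i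
  proof -
    have "rl (A i) p xs" if j: "j \<in> I" "rl (A j) p xs" for j
    proof -
      have "xs \<in> args L (A j) p" using structures_rl_args[OF str[OF j(1)] j(2)] by blast
      from comparable_substructures_rl[OF chain[OF i j(1)] p xs this] j(2)
      show ?thesis by simp
    qed
    then show ?thesis using i by (auto simp: struct_union_def)
  qed
  show U: "?U \<in> structures L"
    unfolding structures_def
  proof (intro CollectI conjI allI impI)
    show "univ ?U \<noteq> {}" using I structures_nonempty[OF str] by (auto simp: univ)
    show "small (univ ?U)" using small by (simp add: univ)
  next
    fix f xs assume fx: "f \<in> fsyms L \<and> xs \<in> args L ?U f"
    then obtain i where i: "i \<in> I" "xs \<in> args L (A i) f" using locate by blast
    have "fn (A i) f xs \<in> univ (A i)" by (rule structures_fn_closed[OF str[OF i(1)] _ i(2)]) (simp add: fx)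
    then show "fn ?U f xs \<in> univ ?U" using fnU[OF _ i] fx i(1) by (auto simp: univ)
  next
    fix f xs assume "\<not> (f \<in> fsyms L \<and> xs \<in> args L ?U f)"
    then have "\<not> (f \<in> fsyms L \<and> (\<exists>i\<in>I. xs \<in> args L (A i) f))" using argsU by blast
    then show "fn ?U f xs = undefined" unfolding struct_union_def by auto
  next
    fix p xs assume "rl ?U p xs"
    then obtain i where i: "i \<in> I" "rl (A i) p xs" by (auto simp: struct_union_def)
    have *: "p \<in> rsyms L \<and> xs \<in> args L (A i) p"
      by (rule structures_rl_args[OF str[OF i(1)] i(2)])
    then show "p \<in> rsyms L" by simp
    show "xs \<in> args L ?U p" by (rule argsU[OF i(1) *[THEN conjunct2]])
  qed
  show "substructure L (A j) ?U" if "j \<in> I" for j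
  proof (rule substructureI)
    show "univ (A j) \<subseteq> univ ?U" using that by (auto simp: univ)
    show "fn (A j) f xs = fn ?U f xs" if "f \<in> fsyms L" "xs \<in> args L (A j) f" for f xs
      using fnU[OF that(1) \<open>j \<in> I\<close> that(2)] by simp
    show "rl (A j) p xs \<longleftrightarrow> rl ?U p xs" if "p \<in> rsyms L" "xs \<in> args L (A j) p" for p xs
      using rlU[OF that(1) \<open>j \<in> I\<close> that(2)] by simp
  qed (use U str[OF that] in simp_all)
  show "substructure L ?U B" if sub: "\<And>i. i \<in> I \<Longrightarrow> substructure L (A i) B" for B
  proof (rule substructureI)
    show "?U \<in> structures L" by (rule U)
    show "B \<in> structures L"
      using I substructure_structures[OF sub] by blast
    show "univ ?U \<subseteq> univ B" unfolding univ by (rule UN_least) (rule substructure_univ[OF sub])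
  next
    fix f xs assume f: "f \<in> fsyms L" and xs: "xs \<in> args L ?U f"
    obtain i where i: "i \<in> I" "xs \<in> args L (A i) f" using locate[OF xs] by blast
    show "fn ?U f xs = fn B f xs"
      using fnU[OF f i] substructure_fn[OF sub[OF i(1)] f i(2)] by simp
  next
    fix p xs assume p: "p \<in> rsyms L" and xs: "xs \<in> args L ?U p"
    obtain i where i: "i \<in> I" "xs \<in> args L (A i) p" using locate[OF xs] by blast
    show "rl ?U p xs \<longleftrightarrow> rl B p xs"
      using rlU[OF p i] substructure_rl[OF sub[OF i(1)] p i(2)] by simp
  qed
qed

section \<open>Loewenheim-Skolem cardinals\<close>

lemma LS_property_Cinfinite:
  assumes "LS_property L K leK \<kappa>"
  shows "Cinfinite \<kappa>"
proof -
  have "natLeq \<le>o \<kappa>"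
    by (rule ordLeq_transitive[OF ordLeq_csum2[OF natLeq_Card_order]])
      (use assms in \<open>unfold LS_property_def, blast\<close>)
  then have "cinfinite \<kappa>"
    by (rule cinfinite_mono) (rule natLeq_cinfinite)
  with assms show ?thesis by (simp add: LS_property_def small_cardinal_def)
qed

text \<open>
  Weakening the relation only makes hulls easier to find. For this reason intersections of
  arbitrarily many relations still have hulls, as long as one relation with hulls lies below all of them.
\<close>

lemma LS_property_mono_rel:
  "\<lbrakk>LS_property L K leK \<kappa>; leK \<subseteq> leK'\<rbrakk> \<Longrightarrow> LS_property L K leK' \<kappa>"
  unfolding LS_property_def by (meson subsetD)

lemma LS_property_mono_card:
  assumes \<kappa>: "LS_property L K leK \<kappa>" and le: "\<kappa> \<le>o \<nu>" and \<nu>: "small_cardinal \<nu>"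
  shows "LS_property L K leK \<nu>"
  unfolding LS_property_def
proof (intro conjI ballI allI impI \<nu>)
  show "lang_card L +c natLeq \<le>o \<nu>"
    using \<kappa> le ordLeq_transitive unfolding LS_property_def by blast
  fix B X assume "B \<in> K" "X \<subseteq> univ B"
  then obtain A where "A \<in> K" "X \<subseteq> univ A" "(A, B) \<in> leK" "|univ A| \<le>o |X| +c \<kappa>"
    using \<kappa> unfolding LS_property_def by meson
  moreover have "|X| +c \<kappa> \<le>o |X| +c \<nu>" by (rule csum_mono2[OF le])
  ultimately show "\<exists>A\<in>K. X \<subseteq> univ A \<and> (A, B) \<in> leK \<and> |univ A| \<le>o |X| +c \<nu>"
    using ordLeq_transitive by blast
qed

text \<open>
  Cardinals are well-ordered, so the least cardinal in the definition of
  \<^const>\<open>LS_number\<close> exists, and the property passes to larger cardinals.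
\<close>

lemma LS_number_le_iff:
  assumes ex: "\<exists>\<kappa>. LS_property L K leK \<kappa>" and \<nu>: "small_cardinal \<nu>"
  shows "LS_number L K leK \<le>o \<nu> \<longleftrightarrow> LS_property L K leK \<nu>"
proof -
  have "\<exists>\<kappa>\<in>{\<kappa>. LS_property L K leK \<kappa>}. \<forall>\<nu>\<in>{\<kappa>. LS_property L K leK \<kappa>}. \<kappa> \<le>o \<nu>"
  proof (rule exists_minim_Card_order)
    show "{\<kappa>. LS_property L K leK \<kappa>} \<noteq> {}" using ex by blast
    show "\<forall>\<kappa>\<in>{\<kappa>. LS_property L K leK \<kappa>}. Card_order \<kappa>" using LS_property_Cinfinite by blast
  qed
  then have "\<exists>\<kappa>. LS_property L K leK \<kappa> \<and> (\<forall>\<nu>. LS_property L K leK \<nu> \<longrightarrow> \<kappa> \<le>o \<nu>)"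
    by auto
  from someI_ex[OF this]
  have least: "LS_property L K leK (LS_number L K leK)"
    "\<And>\<nu>. LS_property L K leK \<nu> \<Longrightarrow> LS_number L K leK \<le>o \<nu>"
    unfolding LS_number_def by blast+
  then show ?thesis using LS_property_mono_card[OF least(1) _ \<nu>] by blast
qed

section \<open>Intersections of AEC relations\<close>

context AEC
begin

lemma le_in_K: "(A, B) \<in> leK \<Longrightarrow> A \<in> K \<and> B \<in> K"
  using le_partial_order by (auto simp: partial_order_on_def preorder_on_def)

text \<open>
  Coherence turns an increasing sequence of \<open>leK\<close>-substructures of \<open>B\<close> into a
  \<open>leK\<close>-chain, which the chain axiom then closes below \<open>B\<close>.
\<close>

lemma omega_chain_union:
  fixes A :: "nat \<Rightarrow> ('s, 'u) struct"
  assumes uncountable: "natLeq <o |UNIV :: 'u set|"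
    and le: "\<And>n. (A n, B) \<in> leK" and mono: "\<And>n. univ (A n) \<subseteq> univ (A (Suc n))"
  shows "\<exists>U. (U, B) \<in> leK \<and> univ U = (\<Union>n. univ (A n))"
proof -
  have "|UNIV :: nat set| \<le>o |UNIV :: 'u set|"
    using uncountable card_of_nat ordIso_ordLeq_trans ordLess_imp_ordLeq by blast
  then obtain f :: "nat \<Rightarrow> 'u" where f: "inj f"
    unfolding card_of_ordLeq[symmetric] by blast
  \<comment> \<open>the chain axiom speaks of well-orders on \<open>'u\<close>, so the indices \<open>n\<close> are replaced by \<open>f n\<close>\<close>
  define r where "r = dir_image natLeq f"
  have r: "(i, j) \<in> r \<longleftrightarrow> (\<exists>m n. i = f m \<and> j = f n \<and> m \<le> n)" for i j
    by (auto simp: r_def dir_image_def natLeq_def)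
  have r_f: "(f m, f n) \<in> r \<longleftrightarrow> m \<le> n" for m n
    using inj_eq[OF f] by (auto simp: r)
  have Field: "Field r = range f"
    by (simp add: r_def dir_image_Field Field_natLeq)
  define C where "C = (\<lambda>i. A (inv_into UNIV f i))"
  have C: "C (f n) = A n" for n
    by (simp add: C_def inv_f_f[OF f])
  have mono': "univ (A m) \<subseteq> univ (A n)" if "m \<le> n" for m n
    by (rule lift_Suc_mono_le[of "\<lambda>n. univ (A n)", OF mono that])
  have wo: "Well_order r"
    unfolding r_def by (rule Well_order_dir_image[OF natLeq_Well_order]) (use f in \<open>simp add: Field_natLeq\<close>)
  have "\<exists>j\<in>range f. i \<noteq> j \<and> (i, j) \<in> r" if "i \<in> range f" for i
  proof -
    obtain n where n: "i = f n" using \<open>i \<in> range f\<close> by blast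
    have "f n \<noteq> f (Suc n)" using inj_eq[OF f] by simp
    then show ?thesis
      using r_f[of n "Suc n"] by (intro bexI[of _ "f (Suc n)"]) (simp_all add: n)
  qed
  then have limit: "limit_order r"
    using wo unfolding limit_order_def by (simp add: Field)
  have no_limit: "\<not> limit_order (Restr r (underS r i))" for i
  proof
    assume lim: "limit_order (Restr r (underS r i))"
    then obtain a where "a \<in> Field (Restr r (underS r i))"
      unfolding limit_order_def by blast
    then have "a \<in> underS r i" by (auto simp: Field_def)
    then obtain m n where mn: "i = f n" "m < n"
      using inj_eq[OF f] by (auto simp: underS_def r order_less_le)
    have under: "f k \<in> underS r i \<longleftrightarrow> k < n" for k
      using inj_eq[OF f] by (auto simp: underS_def mn(1) r_f)
    \<comment> \<open>the predecessor of \<open>n\<close> is a largest index below \<open>n\<close>; continuity therefore demands nothing\<close>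
    have top: "f (n - 1) \<in> Field (Restr r (underS r i))"
      using mn(2) under[of "n - 1"] r_f[of "n - 1" "n - 1"] by (auto simp: Field_def)
    then obtain j where j: "j \<in> underS r i" "f (n - 1) \<noteq> j" "(f (n - 1), j) \<in> r"
      using lim unfolding limit_order_def by (metis IntD1 IntD2 SigmaD2)
    then obtain k where "j = f k" by (auto simp: r)
    then have "k < n" "n - 1 \<le> k" "k \<noteq> n - 1"
      using j under r_f by auto
    then show False by simp
  qed
  have le_A: "(A m, A n) \<in> leK" if "m \<le> n" for m n
    using le[of m] le[of n] le_substructure substructure_of_common_extension mono'[OF that]
    by (blast intro: coherence)
  have chain: "continuous_chain L K leK r C"
    unfolding continuous_chain_def
  proof (intro conjI allI ballI impI)
    show "C i \<in> K" if "i \<in> Field r" for i using le_in_K[OF le] by (simp add: C_def)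
    show "(C i, C j) \<in> leK" if "(i, j) \<in> r" for i j
      using that le_A by (auto simp: r C)
  qed (use no_limit in blast)
  have "|range f| \<le>o |UNIV :: nat set|" by (rule card_of_image)
  then have "small (Field r)"
    unfolding small_def Field using uncountable card_of_nat
    by (blast intro: ordLeq_ordLess_trans ordIso_ordLess_trans)
  from chain_union[OF limit this chain] have "(struct_union L (Field r) C, B) \<in> leK"
    using le by (auto simp: C_def)
  moreover have "univ (struct_union L (Field r) C) = (\<Union>n. univ (A n))"
    by (simp add: struct_union_def Field C)
  ultimately show ?thesis by blast
qed

end

text \<open>
  Apart from the existence of a Loewenheim-Skolem cardinal, an axiom is either a closure condition on
  the relation, and these pass to intersections, or it is inherited by smaller relations, or it speaks
  of \<open>K\<close> alone.
\<close>

lemma AEC_Inter: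
  assumes ne: "S \<noteq> {}" and S: "\<And>leK. leK \<in> S \<Longrightarrow> AEC L K leK"
    and LS: "LS_property L K (\<Inter>S) \<kappa>"
  shows "AEC L K (\<Inter>S)"
proof -
  obtain leK\<^sub>0 where 0: "leK\<^sub>0 \<in> S" using ne by blast
  interpret A0: AEC L K leK\<^sub>0 by (rule S[OF 0])
  show ?thesis
  proof
    show "K \<subseteq> structures L" by (rule A0.K_structures)
    show "B \<in> K" if "A \<in> K" "isomorphism L h A B" for A h B
      using that by (rule A0.iso_closed)
    show "(A', B') \<in> \<Inter>S"
      if "(A, B) \<in> \<Inter>S" "isomorphism L h B B'" "isomorphism L h A A'" for A B h B' A'
      using that AEC.le_iso_closed[OF S] by blast
    show "substructure L A B" if "(A, B) \<in> \<Inter>S" for A B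
      using that 0 A0.le_substructure by blast
    have po: "partial_order_on K leK" if "leK \<in> S" for leK
      using S[OF that] by (rule AEC.le_partial_order)
    show "partial_order_on K (\<Inter>S)"
      unfolding partial_order_on_def preorder_on_def
    proof (intro conjI)
      show "\<Inter>S \<subseteq> K \<times> K" using partial_order_onD(4)[OF po[OF 0]] 0 by blast
      show "refl_on K (\<Inter>S)" using partial_order_onD(1)[OF po] by (simp add: refl_on_def)
      show "trans (\<Inter>S)" using partial_order_onD(2)[OF po] by (intro transI) (blast dest: transD)
      show "antisym (\<Inter>S)" using partial_order_onD(3)[OF po[OF 0]] 0 by (auto simp: antisym_def)
    qed
    show "(A, B) \<in> \<Inter>S"
      if "(A, C) \<in> \<Inter>S" "(B, C) \<in> \<Inter>S" "substructure L A B" for A B C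
      using that AEC.coherence[OF S] by blast
    show "\<exists>\<kappa>. LS_property L K (\<Inter>S) \<kappa>" using LS by blast
  next
    fix r :: "'b rel" and C
    assume r: "limit_order r" "small (Field r)" and C: "continuous_chain L K (\<Inter>S) r C"
    have "continuous_chain L K leK r C" if "leK \<in> S" for leK
      using C that unfolding continuous_chain_def by blast
    note union = AEC.chain_union[OF S r this]
    show "struct_union L (Field r) C \<in> K \<and>
       (\<forall>j\<in>Field r. (C j, struct_union L (Field r) C) \<in> \<Inter>S) \<and>
       (\<forall>B. (\<forall>i\<in>Field r. (C i, B) \<in> \<Inter>S) \<longrightarrow> (struct_union L (Field r) C, B) \<in> \<Inter>S)"
    proof (intro conjI ballI allI impI InterI)
      show "struct_union L (Field r) C \<in> K" using union[OF 0 0] by blast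
      show "(C j, struct_union L (Field r) C) \<in> leK" if "j \<in> Field r" "leK \<in> S" for j leK
        using union[OF that(2) that(2)] that(1) by blast
      show "(struct_union L (Field r) C, B) \<in> leK"
        if B: "\<forall>i\<in>Field r. (C i, B) \<in> \<Inter>S" and leK: "leK \<in> S" for B leK
      proof -
        have "\<forall>i\<in>Field r. (C i, B) \<in> leK" using B leK by blast
        then show ?thesis using union[OF leK leK] by blast
      qed
    qed
  qed
qed

lemma LS_property_hull_function:
  assumes LS: "LS_property L K leK \<kappa>" and B: "B \<in> K"
  shows "\<exists>H. \<forall>Y. Y \<subseteq> univ B \<longrightarrow> (H Y, B) \<in> leK \<and> Y \<subseteq> univ (H Y) \<and> |univ (H Y)| \<le>o |Y| +c \<kappa>"
proof -
  have "\<forall>Y. \<exists>A. Y \<subseteq> univ B \<longrightarrow> (A, B) \<in> leK \<and> Y \<subseteq> univ A \<and> |univ A| \<le>o |Y| +c \<kappa>"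
    using assms unfolding LS_property_def by blast
  then show ?thesis by (rule choice)
qed

text \<open>
  Take hulls for the two relations alternately, each containing the previous one, and let
  \<open>U\<close> be the union after \<open>\<omega>\<close> steps. The odd and the even hulls form two
  chains with the same union, so \<open>U\<close> is below \<open>B\<close> for both relations.
  The bound \<open>|X| +c \<kappa>\<close> is infinite and absorbs \<open>\<kappa>\<close>, so it is
  never exceeded.
\<close>

lemma LS_property_Int:
  fixes leK1 leK2 :: "('s, 'u) struct rel"
  assumes uncountable: "natLeq <o |UNIV :: 'u set|"
    and AEC: "AEC L K leK1" "AEC L K leK2"
    and LS: "LS_property L K leK1 \<kappa>" "LS_property L K leK2 \<kappa>"
  shows "LS_property L K (leK1 \<inter> leK2) \<kappa>"
  unfolding LS_property_def
proof (intro conjI ballI allI impI)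
  show "small_cardinal \<kappa>" "lang_card L +c natLeq \<le>o \<kappa>"
    using LS(1) by (simp_all add: LS_property_def)
next
  interpret A1: AEC L K leK1 by (rule AEC(1))
  interpret A2: AEC L K leK2 by (rule AEC(2))
  fix B X assume B: "B \<in> K" and X: "X \<subseteq> univ B"
  obtain H1 where H1: "\<And>Y. Y \<subseteq> univ B \<Longrightarrow> (H1 Y, B) \<in> leK1" "\<And>Y. Y \<subseteq> univ B \<Longrightarrow> Y \<subseteq> univ (H1 Y)"
    "\<And>Y. Y \<subseteq> univ B \<Longrightarrow> |univ (H1 Y)| \<le>o |Y| +c \<kappa>"
    using LS_property_hull_function[OF LS(1) B] by blast
  obtain H2 where H2: "\<And>Y. Y \<subseteq> univ B \<Longrightarrow> (H2 Y, B) \<in> leK2" "\<And>Y. Y \<subseteq> univ B \<Longrightarrow> Y \<subseteq> univ (H2 Y)"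
    "\<And>Y. Y \<subseteq> univ B \<Longrightarrow> |univ (H2 Y)| \<le>o |Y| +c \<kappa>"
    using LS_property_hull_function[OF LS(2) B] by blast
  have H1B: "univ (H1 Y) \<subseteq> univ B" if "Y \<subseteq> univ B" for Y
    using substructure_univ[OF A1.le_substructure[OF H1(1)[OF that]]] .
  have H2B: "univ (H2 Y) \<subseteq> univ B" if "Y \<subseteq> univ B" for Y
    using substructure_univ[OF A2.le_substructure[OF H2(1)[OF that]]] .
  note \<kappa> = LS_property_Cinfinite[OF LS(1)]
  let ?\<mu> = "|X| +c \<kappa>"
  have \<kappa>\<mu>: "\<kappa> \<le>o ?\<mu>" by (rule ordLeq_csum2) (use \<kappa> in simp)
  have \<mu>: "Cinfinite ?\<mu>"
    using cinfinite_mono[OF \<kappa>\<mu>] \<kappa> by (simp add: Card_order_csum)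
  have absorb: "|Y| +c \<kappa> \<le>o ?\<mu>" if "|Y| \<le>o ?\<mu>" for Y :: "'u set"
    using that \<kappa>\<mu> card_of_Card_order conjunct2[OF \<kappa>] \<mu> by (rule csum_cinfinite_bound)
  define Z where "Z = (\<lambda>n. ((\<lambda>Y. univ (H2 (univ (H1 Y)))) ^^ n) X)"
  define E where "E = (\<lambda>n. H1 (Z n))"
  define F where "F = (\<lambda>n. H2 (univ (E n)))"
  have Z0: "Z 0 = X" by (simp add: Z_def)
  have ZSuc: "Z (Suc n) = univ (F n)" for n by (simp add: Z_def E_def F_def)
  have Z: "Z n \<subseteq> univ B \<and> |Z n| \<le>o ?\<mu>" for n
  proof (induction n)
    case 0
    show ?case using X ordLeq_csum1[OF card_of_Card_order] by (simp add: Z0)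
  next
    case (Suc n)
    then have "|univ (E n)| \<le>o ?\<mu>"
      unfolding E_def using H1(3) absorb ordLeq_transitive by blast
    moreover have E: "univ (E n) \<subseteq> univ B" using Suc H1B by (simp add: E_def)
    ultimately have "|univ (F n)| \<le>o ?\<mu>"
      unfolding F_def using H2(3) absorb ordLeq_transitive by blast
    with H2B[OF E] show ?case by (simp add: ZSuc F_def)
  qed
  have ZE: "Z n \<subseteq> univ (E n)" for n using Z H1(2) by (simp add: E_def)
  have EB: "univ (E n) \<subseteq> univ B" for n using Z H1B by (simp add: E_def)
  have EZ: "univ (E n) \<subseteq> Z (Suc n)" for n using H2(2)[OF EB] by (simp add: ZSuc F_def)
  obtain U where U: "(U, B) \<in> leK1" "univ U = (\<Union>n. univ (E n))"
  proof (atomize_elim, rule A1.omega_chain_union[OF uncountable])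
    show "(E n, B) \<in> leK1" for n using Z H1(1) by (simp add: E_def)
    show "univ (E n) \<subseteq> univ (E (Suc n))" for n using EZ ZE by (rule subset_trans)
  qed
  obtain V where V: "(V, B) \<in> leK2" "univ V = (\<Union>n. univ (F n))"
  proof (atomize_elim, rule A2.omega_chain_union[OF uncountable])
    show "(F n, B) \<in> leK2" for n using H2(1)[OF EB] by (simp add: F_def)
    show "univ (F n) \<subseteq> univ (F (Suc n))" for n
      using ZE EZ unfolding ZSuc[symmetric] by (rule subset_trans)
  qed
  have "univ (E n) \<subseteq> univ V" for n using EZ[of n] unfolding ZSuc V(2) by blast
  moreover have "univ (F n) \<subseteq> univ U" for n using ZE[of "Suc n"] unfolding ZSuc U(2) by blast
  ultimately have "univ U = univ V" unfolding U(2) V(2) by blast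
  then have "U = V"
    by (rule substructure_eqI[OF A1.le_substructure[OF U(1)] A2.le_substructure[OF V(1)]])
  then have "(U, B) \<in> leK1 \<inter> leK2" using U V by simp
  moreover have "X \<subseteq> univ U" using ZE[of 0] unfolding Z0 U(2) by blast
  moreover have "|univ V| \<le>o ?\<mu>"
    unfolding V(2) ZSuc[symmetric] using \<mu> Z card_of_nat_ordLeq_Cinfinite[OF \<mu>]
    by (intro card_of_UNION_ordLeq_infinite_Field) (simp_all add: cinfinite_def)
  ultimately show "\<exists>A\<in>K. X \<subseteq> univ A \<and> (A, B) \<in> leK1 \<inter> leK2 \<and> |univ A| \<le>o ?\<mu>"
    using A1.le_in_K[OF U(1)] \<open>U = V\<close> by (intro bexI[of _ U]) simp_all
qed

section \<open>Modules as a universal class\<close>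

text \<open>
  The laws of modules as equations in three elements. Since they are universal, they pass to
  substructures, and since any three elements of the union of a chain lie in one member, they pass
  to such unions.
\<close>

definition module_laws ::
  "('r, 'b) ring_scheme \<Rightarrow> ('r mod_sym, 'u) struct \<Rightarrow> 'u \<Rightarrow> 'u \<Rightarrow> 'u \<Rightarrow> bool" where
  "module_laws R M x y z \<longleftrightarrow>
     mplus M (mplus M x y) z = mplus M x (mplus M y z) \<and>
     mplus M x y = mplus M y x \<and>
     mplus M (mzero M) x = x \<and>
     mplus M x (mminus M x) = mzero M \<and>
     (\<forall>r\<in>carrier R. mscal M r (mplus M x y) = mplus M (mscal M r x) (mscal M r y)) \<and>
     (\<forall>r\<in>carrier R. \<forall>s\<in>carrier R. mscal M (r \<oplus>\<^bsub>R\<^esub> s) x = mplus M (mscal M r x) (mscal M s x)) \<and>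
     (\<forall>r\<in>carrier R. \<forall>s\<in>carrier R. mscal M (r \<otimes>\<^bsub>R\<^esub> s) x = mscal M r (mscal M s x)) \<and>
     mscal M \<one>\<^bsub>R\<^esub> x = x"

lemma mod_lang_simps [simp]:
  "fsyms (mod_lang R) = {Zero, Plus, Minus} \<union> Scal ` carrier R"
  "rsyms (mod_lang R) = {}"
  "arity (mod_lang R) Zero = 0" "arity (mod_lang R) Plus = 2"
  "arity (mod_lang R) Minus = 1" "arity (mod_lang R) (Scal r) = 1"
  by (simp_all add: mod_lang_def)

lemma mod_args:
  "[] \<in> args (mod_lang R) M Zero"
  "\<lbrakk>x \<in> univ M; y \<in> univ M\<rbrakk> \<Longrightarrow> [x, y] \<in> args (mod_lang R) M Plus"
  "x \<in> univ M \<Longrightarrow> [x] \<in> args (mod_lang R) M Minus"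
  "x \<in> univ M \<Longrightarrow> [x] \<in> args (mod_lang R) M (Scal r)"
  by (simp_all add: args_def)

lemma mod_closed:
  assumes "M \<in> structures (mod_lang R)"
  shows "mzero M \<in> univ M"
    and "\<lbrakk>x \<in> univ M; y \<in> univ M\<rbrakk> \<Longrightarrow> mplus M x y \<in> univ M"
    and "x \<in> univ M \<Longrightarrow> mminus M x \<in> univ M"
    and "\<lbrakk>r \<in> carrier R; x \<in> univ M\<rbrakk> \<Longrightarrow> mscal M r x \<in> univ M"
  by (rule structures_fn_closed[OF assms]; simp add: mod_args)+

lemma RMod_iff_module_laws:
  "M \<in> RMod R \<longleftrightarrow> M \<in> structures (mod_lang R) \<and>
     (\<forall>x\<in>univ M. \<forall>y\<in>univ M. \<forall>z\<in>univ M. module_laws R M x y z)"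
proof (intro iffI conjI ballI)
  assume M: "M \<in> RMod R"
  show "M \<in> structures (mod_lang R)" using M by (simp add: RMod_def)
  fix x y z assume xyz: "x \<in> univ M" "y \<in> univ M" "z \<in> univ M"
  interpret G: comm_group "\<lparr> carrier = univ M, mult = mplus M, one = mzero M \<rparr>"
    using M by (simp add: RMod_def)
  have "mplus M (mplus M x y) z = mplus M x (mplus M y z)" "mplus M x y = mplus M y x"
    "mplus M (mzero M) x = x"
    using xyz G.m_assoc[of x y z] G.m_comm[of x y] G.l_one[of x] by simp_all
  then show "module_laws R M x y z"
    using M xyz unfolding module_laws_def RMod_def by blast
next
  assume M: "M \<in> structures (mod_lang R) \<and>
    (\<forall>x\<in>univ M. \<forall>y\<in>univ M. \<forall>z\<in>univ M. module_laws R M x y z)"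
  then have laws: "module_laws R M x y z" if "x \<in> univ M" "y \<in> univ M" "z \<in> univ M" for x y z
    using that by blast
  note closed = mod_closed[OF conjunct1[OF M]]
  \<comment> \<open>inverses are given by the symbol for negation\<close>
  have "comm_group \<lparr> carrier = univ M, mult = mplus M, one = mzero M \<rparr>"
  proof (rule comm_groupI; simp add: closed)
    show "mplus M (mplus M x y) z = mplus M x (mplus M y z)"
      if "x \<in> univ M" "y \<in> univ M" "z \<in> univ M" for x y z
      using laws[OF that] unfolding module_laws_def by blast
    show comm: "mplus M x y = mplus M y x" if "x \<in> univ M" "y \<in> univ M" for x y
      using laws[OF that that(1)] unfolding module_laws_def by blast
    show "mplus M (mzero M) x = x" if "x \<in> univ M" for x
      using laws[OF that that that] unfolding module_laws_def by blast
    show "\<exists>y\<in>univ M. mplus M y x = mzero M" if "x \<in> univ M" for x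
    proof (rule bexI[OF _ closed(3)[OF that]])
      have "mplus M x (mminus M x) = mzero M"
        using laws[OF that that that] unfolding module_laws_def by blast
      then show "mplus M (mminus M x) x = mzero M" by (simp add: comm[OF that closed(3)[OF that]])
    qed
  qed
  with M show "M \<in> RMod R"
    by (simp add: RMod_def module_laws_def)
qed

text \<open>
  An embedding commutes with every term of the language and reflects equality, so it
  both preserves and reflects equations.
\<close>

lemma module_laws_embedding:
  fixes R :: "('r, 'b) ring_scheme"
  assumes R: "ring R"
    and A: "A \<in> structures (mod_lang R)" and inj: "inj_on h (univ A)"
    and hom: "\<And>f xs. \<lbrakk>f \<in> fsyms (mod_lang R); xs \<in> args (mod_lang R) A f\<rbrakk>
      \<Longrightarrow> h (fn A f xs) = fn B f (map h xs)"
    and xyz: "x \<in> univ A" "y \<in> univ A" "z \<in> univ A"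
  shows "module_laws R B (h x) (h y) (h z) \<longleftrightarrow> module_laws R A x y z"
proof -
  note closed = mod_closed[OF A]
  have h_ops: "mzero B = h (mzero A)"
    "\<And>x y. \<lbrakk>x \<in> univ A; y \<in> univ A\<rbrakk> \<Longrightarrow> mplus B (h x) (h y) = h (mplus A x y)"
    "\<And>x. x \<in> univ A \<Longrightarrow> mminus B (h x) = h (mminus A x)"
    "\<And>r x. \<lbrakk>r \<in> carrier R; x \<in> univ A\<rbrakk> \<Longrightarrow> mscal B r (h x) = h (mscal A r x)"
    by (subst hom; simp add: mod_args)+
  have R_closed: "\<one>\<^bsub>R\<^esub> \<in> carrier R"
    "\<And>r s. \<lbrakk>r \<in> carrier R; s \<in> carrier R\<rbrakk> \<Longrightarrow> r \<oplus>\<^bsub>R\<^esub> s \<in> carrier R"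
    "\<And>r s. \<lbrakk>r \<in> carrier R; s \<in> carrier R\<rbrakk> \<Longrightarrow> r \<otimes>\<^bsub>R\<^esub> s \<in> carrier R"
    using R by (simp_all add: ring.ring_simprules)
  show ?thesis
    using xyz by (simp add: module_laws_def h_ops closed R_closed inj_on_eq_iff[OF inj])
qed

lemma module_laws_substructure:
  assumes "ring R" "substructure (mod_lang R) A B"
    and "x \<in> univ A" "y \<in> univ A" "z \<in> univ A"
  shows "module_laws R B x y z \<longleftrightarrow> module_laws R A x y z"
  using module_laws_embedding[of R A id B x y z] assms substructure_structures[OF assms(2)]
    substructure_fn[OF assms(2)]
  by (simp del: mod_lang_simps)

lemma RMod_substructure:
  assumes "ring R" "substructure (mod_lang R) A B" "B \<in> RMod R"
  shows "A \<in> RMod R"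
  using assms(3) module_laws_substructure[OF assms(1,2)] substructure_univ[OF assms(2)]
    substructure_structures[OF assms(2)]
  unfolding RMod_iff_module_laws by blast

lemma RMod_isomorphic:
  assumes R: "ring R" and A: "A \<in> RMod R" and h: "isomorphism (mod_lang R) h A B"
  shows "B \<in> RMod R"
  unfolding RMod_iff_module_laws
proof (intro conjI ballI)
  show "B \<in> structures (mod_lang R)" using h by (simp add: isomorphism_def)
  have str: "A \<in> structures (mod_lang R)" and bij: "bij_betw h (univ A) (univ B)"
    using h by (simp_all add: isomorphism_def)
  fix x y z assume "x \<in> univ B" "y \<in> univ B" "z \<in> univ B"
  then obtain a b c where "a \<in> univ A" "b \<in> univ A" "c \<in> univ A" "x = h a" "y = h b" "z = h c"
    using bij_betw_imp_surj_on[OF bij] by blast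
  moreover from this have "module_laws R A a b c"
    using A by (simp add: RMod_iff_module_laws)
  moreover have "h (fn A f xs) = fn B f (map h xs)"
    if "f \<in> fsyms (mod_lang R)" "xs \<in> args (mod_lang R) A f" for f xs
    using h that by (simp add: isomorphism_def del: mod_lang_simps)
  ultimately show "module_laws R B x y z"
    using module_laws_embedding[OF R str bij_betw_imp_inj_on[OF bij], of B a b c] by blast
qed

lemma RMod_struct_union:
  assumes R: "ring R" and I: "I \<noteq> {}" and A: "\<And>i. i \<in> I \<Longrightarrow> A i \<in> RMod R"
    and chain: "\<And>i j. \<lbrakk>i \<in> I; j \<in> I\<rbrakk> \<Longrightarrow>
      substructure (mod_lang R) (A i) (A j) \<or> substructure (mod_lang R) (A j) (A i)"
    and small: "small (\<Union>i\<in>I. univ (A i))"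
  shows "struct_union (mod_lang R) I A \<in> RMod R"
  unfolding RMod_iff_module_laws
proof (intro conjI ballI)
  let ?U = "struct_union (mod_lang R) I A"
  show "?U \<in> structures (mod_lang R)" by (rule struct_union_structure[OF I chain small])
  fix x y z assume "x \<in> univ ?U" "y \<in> univ ?U" "z \<in> univ ?U"
  then have "set [x, y, z] \<subseteq> (\<Union>i\<in>I. univ (A i))" by (simp add: struct_union_def)
  moreover have "univ (A i) \<subseteq> univ (A j) \<or> univ (A j) \<subseteq> univ (A i)" if "i \<in> I" "j \<in> I" for i j
    using chain[OF that] substructure_univ by blast
  ultimately obtain i where i: "i \<in> I" "set [x, y, z] \<subseteq> univ (A i)"
    using list_in_chain_union[of I "\<lambda>i. univ (A i)"] I by blast
  then have xyz: "x \<in> univ (A i)" "y \<in> univ (A i)" "z \<in> univ (A i)" by simp_all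
  then have "module_laws R (A i) x y z"
    using A[OF i(1)] by (simp add: RMod_iff_module_laws)
  then show "module_laws R ?U x y z"
    using module_laws_substructure[OF R struct_union_upper[OF I chain small i(1)] xyz] by blast
qed

section \<open>The submodule relation\<close>

lemma lang_card_mod_lang:
  assumes "|carrier R| \<le>o \<kappa>" "Cinfinite \<kappa>"
  shows "lang_card (mod_lang R) \<le>o \<kappa>"
proof -
  have "|Scal ` carrier R| \<le>o \<kappa>" by (rule ordLeq_transitive[OF card_of_image assms(1)])
  moreover have "|{Zero, Plus, Minus} :: 'a mod_sym set| \<le>o \<kappa>"
    by (rule card_of_finite_ordLeq_Cinfinite[OF assms(2)]) simp
  ultimately have "|{Zero, Plus, Minus} \<union> Scal ` carrier R| \<le>o \<kappa>"
    using assms(2) by (intro card_of_Un_ordLeq_infinite_Field) (simp_all add: cinfinite_def)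
  then show ?thesis by (simp add: lang_card_def)
qed

lemma card_carrier_le_lang_card: "|carrier R| \<le>o lang_card (mod_lang R)"
  unfolding lang_card_def card_of_ordLeq[symmetric]
  by (intro exI[of _ Scal]) (auto simp: inj_on_def)

lemma admissible_cardinal_Cinfinite:
  assumes "admissible_cardinal R \<kappa>"
  shows "Cinfinite \<kappa>"
proof -
  have "natLeq \<le>o \<kappa>"
    by (rule ordLeq_transitive[OF ordLeq_csum2[OF natLeq_Card_order]])
      (use assms in \<open>unfold admissible_cardinal_def, blast\<close>)
  then have "cinfinite \<kappa>" by (rule cinfinite_mono) (rule natLeq_cinfinite)
  with assms show ?thesis by (simp add: admissible_cardinal_def small_cardinal_def)
qed

lemma admissible_cardinal_carrier: "admissible_cardinal R \<kappa> \<Longrightarrow> |carrier R| \<le>o \<kappa>"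
  unfolding admissible_cardinal_def
  using ordLeq_transitive[OF ordLeq_csum1[OF card_of_Card_order]] by blast

text \<open>
  The language has a symbol for each ring element, so a Loewenheim-Skolem cardinal of any AEC of
  modules already bounds the size of the ring.
\<close>

lemma LS_property_admissible:
  assumes "LS_property (mod_lang R) K leK \<kappa>"
  shows "admissible_cardinal R \<kappa>"
  unfolding admissible_cardinal_def
proof
  show "small_cardinal \<kappa>" using assms by (simp add: LS_property_def)
  have "|carrier R| +c natLeq \<le>o lang_card (mod_lang R) +c natLeq"
    by (rule csum_mono1[OF card_carrier_le_lang_card])
  then show "|carrier R| +c natLeq \<le>o \<kappa>"
    using assms ordLeq_transitive unfolding LS_property_def by blast
qed

lemma LS_property_submodule_rel:
  assumes R: "ring R" and \<kappa>: "admissible_cardinal R \<kappa>"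
  shows "LS_property (mod_lang R) (RMod R) (submodule_rel R) \<kappa>"
  unfolding LS_property_def
proof (intro conjI ballI allI impI)
  note inf = admissible_cardinal_Cinfinite[OF \<kappa>]
  note R\<kappa> = admissible_cardinal_carrier[OF \<kappa>]
  show "small_cardinal \<kappa>" using \<kappa> by (simp add: admissible_cardinal_def)
  have nat: "natLeq \<le>o \<kappa>" using inf by (blast intro: natLeq_ordLeq_cinfinite)
  show "lang_card (mod_lang R) +c natLeq \<le>o \<kappa>"
    by (rule csum_cinfinite_bound[OF lang_card_mod_lang[OF R\<kappa> inf] nat _ natLeq_Card_order inf])
      (simp add: lang_card_def card_of_Card_order del: mod_lang_simps)
  fix B X assume B: "B \<in> RMod R" and X: "X \<subseteq> univ B"
  let ?\<mu> = "|X| +c \<kappa>"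
  have \<kappa>\<mu>: "\<kappa> \<le>o ?\<mu>" by (rule ordLeq_csum2) (use inf in simp)
  have \<mu>: "Cinfinite ?\<mu>"
    using cinfinite_mono[OF \<kappa>\<mu>] inf by (simp add: Card_order_csum)
  have "|fsyms (mod_lang R)| \<le>o ?\<mu>"
    using lang_card_mod_lang[OF ordLeq_transitive[OF R\<kappa> \<kappa>\<mu>] \<mu>] by (simp add: lang_card_def)
  moreover have str: "B \<in> structures (mod_lang R)" using B by (simp add: RMod_def)
  ultimately obtain A where A: "substructure (mod_lang R) A B" "X \<subseteq> univ A" "|univ A| \<le>o ?\<mu>"
    using substructure_hull[OF str X ordLeq_csum1[OF card_of_Card_order] \<mu>] by blast
  then show "\<exists>A\<in>RMod R. X \<subseteq> univ A \<and> (A, B) \<in> submodule_rel R \<and> |univ A| \<le>o ?\<mu>"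
    using RMod_substructure[OF R A(1) B] B by (intro bexI[of _ A]) (simp_all add: submodule_rel_def)
qed

lemma Cinfinite_UNIV: "natLeq <o |UNIV :: 'u set| \<Longrightarrow> Cinfinite |UNIV :: 'u set|"
  using cinfinite_mono[OF ordLess_imp_ordLeq natLeq_cinfinite] card_of_Card_order by blast

text \<open>
  Regularity of the cardinality of \<open>'u\<close> is what makes the union of a small chain of
  small modules small.
\<close>

lemma AEC_submodule_rel:
  fixes R :: "('r, 'b) ring_scheme"
  assumes uncountable: "natLeq <o |UNIV :: 'u set|" and regular: "regularCard |UNIV :: 'u set|"
    and R: "ring R" and \<kappa>: "admissible_cardinal R (\<kappa> :: 'u rel)"
  shows "AEC (mod_lang R) (RMod R) (submodule_rel R :: ('r mod_sym, 'u) struct rel)"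
proof
  show "RMod R \<subseteq> structures (mod_lang R)" by (auto simp: RMod_def)
  show "B \<in> RMod R" if "A \<in> RMod R" "isomorphism (mod_lang R) h A B" for A h and B :: "('r mod_sym, 'u) struct"
    using R that by (rule RMod_isomorphic)
  show "(A', B') \<in> submodule_rel R"
    if "(A, B) \<in> submodule_rel R" "isomorphism (mod_lang R) h B B'" "isomorphism (mod_lang R) h A A'"
    for A B h A' and B' :: "('r mod_sym, 'u) struct"
    using that RMod_isomorphic[OF R] substructure_isomorphic unfolding submodule_rel_def by blast
  show "substructure (mod_lang R) A B" if "(A, B) \<in> submodule_rel R" for A and B :: "('r mod_sym, 'u) struct"
    using that by (simp add: submodule_rel_def)
  show "partial_order_on (RMod R) (submodule_rel R :: ('r mod_sym, 'u) struct rel)"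
    unfolding partial_order_on_def preorder_on_def
  proof (intro conjI)
    show "submodule_rel R \<subseteq> RMod R \<times> (RMod R :: ('r mod_sym, 'u) struct set)"
      by (auto simp: submodule_rel_def)
    show "refl_on (RMod R) (submodule_rel R :: ('r mod_sym, 'u) struct rel)"
      by (auto simp: refl_on_def submodule_rel_def RMod_def intro: substructure_refl)
    show "trans (submodule_rel R :: ('r mod_sym, 'u) struct rel)"
      by (rule transI) (auto simp: submodule_rel_def intro: substructure_trans)
    show "antisym (submodule_rel R :: ('r mod_sym, 'u) struct rel)"
      by (rule antisymI) (auto simp: submodule_rel_def intro: substructure_antisym)
  qed
  show "(A, B) \<in> submodule_rel R"
    if "(A, C) \<in> submodule_rel R" "(B, C) \<in> submodule_rel R" "substructure (mod_lang R) A B"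
    for A B and C :: "('r mod_sym, 'u) struct"
    using that by (simp add: submodule_rel_def)
  show "\<exists>\<kappa>. LS_property (mod_lang R) (RMod R) (submodule_rel R :: ('r mod_sym, 'u) struct rel) \<kappa>"
    using LS_property_submodule_rel[OF R \<kappa>] by blast
next
  fix r :: "'u rel" and C :: "'u \<Rightarrow> ('r mod_sym, 'u) struct"
  assume r: "limit_order r" and small_r: "small (Field r)"
    and C: "continuous_chain (mod_lang R) (RMod R) (submodule_rel R) r C"
  let ?I = "Field r" and ?U = "struct_union (mod_lang R) (Field r) C"
  have ne: "?I \<noteq> {}" and wo: "wo_rel r" using r by (simp_all add: limit_order_def wo_rel_def)
  have CM: "C i \<in> RMod R" if "i \<in> ?I" for i
    using C that by (simp add: continuous_chain_def)
  have chain: "substructure (mod_lang R) (C i) (C j) \<or> substructure (mod_lang R) (C j) (C i)"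
    if "i \<in> ?I" "j \<in> ?I" for i j
    using wo_rel.TOTALS[OF wo] that C unfolding continuous_chain_def submodule_rel_def by blast
  have "stable |UNIV :: 'u set|"
    using regularCard_stable[OF _ _ regular] Cinfinite_UNIV[OF uncountable] by (simp add: cinfinite_def)
  then have small: "small (\<Union>i\<in>?I. univ (C i))"
    unfolding small_def
    by (rule stable_UNION) (use small_r CM in \<open>auto simp: small_def RMod_def structures_def\<close>)
  have UM: "?U \<in> RMod R" by (rule RMod_struct_union[OF R ne CM chain small])
  moreover have "(C j, ?U) \<in> submodule_rel R" if "j \<in> ?I" for j
    using CM[OF that] UM struct_union_upper[OF ne chain small that] by (simp add: submodule_rel_def)
  moreover have "(?U, B) \<in> submodule_rel R" if "\<forall>i\<in>?I. (C i, B) \<in> submodule_rel R" for B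
  proof -
    have "substructure (mod_lang R) ?U B"
      by (rule struct_union_least[OF ne chain small]) (use that in \<open>simp_all add: submodule_rel_def\<close>)
    then show ?thesis using that ne UM by (auto simp: submodule_rel_def)
  qed
  ultimately show "?U \<in> RMod R \<and> (\<forall>j\<in>?I. (C j, ?U) \<in> submodule_rel R) \<and>
     (\<forall>B. (\<forall>i\<in>?I. (C i, B) \<in> submodule_rel R) \<longrightarrow> (?U, B) \<in> submodule_rel R)"
    by blast
qed

lemma AEC_le_submodule_rel:
  assumes "AEC (mod_lang R) (RMod R) leK"
  shows "leK \<subseteq> submodule_rel R"
proof (rule subrelI)
  fix A B assume AB: "(A, B) \<in> leK"
  show "(A, B) \<in> submodule_rel R"
    using AEC.le_in_K[OF assms AB] AEC.le_substructure[OF assms AB] by (simp add: submodule_rel_def)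
qed

lemma admissible_cardinal_exists:
  assumes uncountable: "natLeq <o |UNIV :: 'u set|" and R: "|carrier R| <o |UNIV :: 'u set|"
  shows "\<exists>\<kappa> :: 'u rel. admissible_cardinal R \<kappa>"
proof -
  have inf: "infinite (UNIV :: 'u set)"
    using Cinfinite_UNIV[OF uncountable] by (simp add: cinfinite_def Field_card_of)
  have "|UNIV :: nat set| <o |UNIV :: 'u set|"
    by (rule ordIso_ordLess_trans[OF card_of_nat uncountable])
  then have less: "|carrier R <+> (UNIV :: nat set)| <o |UNIV :: 'u set|"
    by (rule card_of_Plus_ordLess_infinite[OF inf R])
  then obtain Y :: "'u set" where Y: "|carrier R <+> (UNIV :: nat set)| =o |Y|"
    using internalize_card_of_ordLeq[of "carrier R <+> (UNIV :: nat set)" "|UNIV :: 'u set|"]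
      ordLess_imp_ordLeq[OF less] by blast
  have "admissible_cardinal R |Y|"
    unfolding admissible_cardinal_def small_cardinal_def
  proof (intro conjI)
    show "Card_order |Y|" by (rule card_of_Card_order)
    show "|Y| <o |UNIV :: 'u set|" by (rule ordIso_ordLess_trans[OF ordIso_symmetric[OF Y] less])
    have "|carrier R| +c natLeq =o |carrier R <+> (UNIV :: nat set)|"
      by (simp add: csum_def Field_card_of Field_natLeq card_of_refl)
    then show "|carrier R| +c natLeq \<le>o |Y|"
      using Y by (blast intro: ordIso_transitive ordIso_imp_ordLeq)
  qed
  then show ?thesis by blast
qed

section \<open>The lattices\<close>

text \<open>
  In reverse inclusion a join has to be the largest member inside both sets, and a meet the smallest
  member that contains both.
\<close>

lemma lattice_reverse_inclusion:
  assumes Int: "\<And>x y. \<lbrakk>x \<in> S; y \<in> S\<rbrakk> \<Longrightarrow> x \<inter> y \<in> S"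
    and Inter: "\<And>x y. \<lbrakk>x \<in> S; y \<in> S\<rbrakk> \<Longrightarrow> \<Inter>{z \<in> S. x \<union> y \<subseteq> z} \<in> S"
  shows "lattice (reverse_inclusion S)"
proof
  fix x y assume "x \<in> carrier (reverse_inclusion S)" "y \<in> carrier (reverse_inclusion S)"
  then have S: "x \<in> S" "y \<in> S" by (simp_all add: reverse_inclusion_def)
  show "\<exists>s. least (reverse_inclusion S) s (Upper (reverse_inclusion S) {x, y})"
    using S Int[OF S] by (intro exI[of _ "x \<inter> y"]) (auto simp: least_def Upper_def reverse_inclusion_def)
  show "\<exists>s. greatest (reverse_inclusion S) s (Lower (reverse_inclusion S) {x, y})"
    using S Inter[OF S]
    by (intro exI[of _ "\<Inter>{z \<in> S. x \<union> y \<subseteq> z}"])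
      (auto simp: greatest_def Lower_def reverse_inclusion_def)
qed (auto simp: reverse_inclusion_def)

lemma aec_rels_bounded_iff:
  assumes "admissible_cardinal R \<kappa>"
  shows "leK \<in> aec_rels_bounded R \<kappa> \<longleftrightarrow>
    AEC (mod_lang R) (RMod R) leK \<and> LS_property (mod_lang R) (RMod R) leK \<kappa> \<and>
    (\<forall>A B. direct_summand R A B \<longrightarrow> (A, B) \<in> leK)"
proof (cases "AEC (mod_lang R) (RMod R) leK")
  case True
  have "small_cardinal \<kappa>" using assms by (simp add: admissible_cardinal_def)
  from LS_number_le_iff[OF AEC.LS[OF True] this] True show ?thesis
    by (simp add: aec_rels_bounded_def)
next
  case False
  then show ?thesis by (simp add: aec_rels_bounded_def)
qed

text \<open>
  Every AEC has some Loewenheim-Skolem cardinal, and it is automatically admissible, so the union over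
  all admissible cardinals imposes no bound.
\<close>

lemma aec_rels_iff:
  "leK \<in> aec_rels R \<longleftrightarrow>
    AEC (mod_lang R) (RMod R) leK \<and> (\<forall>A B. direct_summand R A B \<longrightarrow> (A, B) \<in> leK)"
proof
  show "AEC (mod_lang R) (RMod R) leK \<and> (\<forall>A B. direct_summand R A B \<longrightarrow> (A, B) \<in> leK)"
    if "leK \<in> aec_rels R"
    using that by (auto simp: aec_rels_def aec_rels_bounded_def)
next
  assume leK: "AEC (mod_lang R) (RMod R) leK \<and> (\<forall>A B. direct_summand R A B \<longrightarrow> (A, B) \<in> leK)"
  then obtain \<kappa> where \<kappa>: "LS_property (mod_lang R) (RMod R) leK \<kappa>"
    using AEC.LS by blast
  have adm: "admissible_cardinal R \<kappa>" by (rule LS_property_admissible[OF \<kappa>])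
  then have "leK \<in> aec_rels_bounded R \<kappa>" using leK \<kappa> by (simp add: aec_rels_bounded_iff)
  with adm show "leK \<in> aec_rels R" by (auto simp: aec_rels_def)
qed

lemma aec_rels_bounded_mono:
  assumes "leK \<in> aec_rels_bounded R \<kappa>" "admissible_cardinal R \<kappa>" "\<kappa> \<le>o \<nu>" "admissible_cardinal R \<nu>"
  shows "leK \<in> aec_rels_bounded R \<nu>"
proof -
  have "LS_property (mod_lang R) (RMod R) leK \<nu>"
    by (rule LS_property_mono_card[OF _ assms(3)])
      (use assms in \<open>simp_all only: aec_rels_bounded_iff admissible_cardinal_def\<close>)
  with assms(1) show ?thesis
    unfolding aec_rels_bounded_iff[OF assms(2)] aec_rels_bounded_iff[OF assms(4)] by blast
qed

lemma aec_rels_bounded_Int: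
  fixes leK1 leK2 :: "('r mod_sym, 'u) struct rel" and R :: "('r, 'b) ring_scheme"
  assumes uncountable: "natLeq <o |UNIV :: 'u set|" and \<kappa>: "admissible_cardinal R \<kappa>"
    and leK1: "leK1 \<in> aec_rels_bounded R \<kappa>" and leK2: "leK2 \<in> aec_rels_bounded R \<kappa>"
  shows "leK1 \<inter> leK2 \<in> aec_rels_bounded R \<kappa>"
proof -
  note iff = aec_rels_bounded_iff[OF \<kappa>]
  have LS: "LS_property (mod_lang R) (RMod R) (leK1 \<inter> leK2) \<kappa>"
    using leK1 leK2 unfolding iff by (intro LS_property_Int[OF uncountable]) simp_all
  have "AEC (mod_lang R) (RMod R) (\<Inter>{leK1, leK2})"
    using leK1 leK2 LS unfolding iff by (intro AEC_Inter[where \<kappa> = \<kappa>]) auto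
  with LS leK1 leK2 show ?thesis unfolding iff by simp
qed

text \<open>
  By monotonicity in the cardinal both relations may be taken to have the larger of the two bounds.
\<close>

lemma aec_rels_Int:
  fixes leK1 leK2 :: "('r mod_sym, 'u) struct rel" and R :: "('r, 'b) ring_scheme"
  assumes uncountable: "natLeq <o |UNIV :: 'u set|"
    and "leK1 \<in> aec_rels R" and "leK2 \<in> aec_rels R"
  shows "leK1 \<inter> leK2 \<in> aec_rels R"
proof -
  obtain \<kappa>1 \<kappa>2 where \<kappa>: "admissible_cardinal R \<kappa>1" "leK1 \<in> aec_rels_bounded R \<kappa>1"
    "admissible_cardinal R \<kappa>2" "leK2 \<in> aec_rels_bounded R \<kappa>2"
    using assms(2,3) by (auto simp: aec_rels_def)
  have "Well_order \<kappa>1" "Well_order \<kappa>2"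
    using admissible_cardinal_Cinfinite[OF \<kappa>(1)] admissible_cardinal_Cinfinite[OF \<kappa>(3)]
    by (auto simp: card_order_on_well_order_on)
  then have "\<kappa>1 \<le>o \<kappa>2 \<or> \<kappa>2 \<le>o \<kappa>1" by (rule ordLeq_total)
  then obtain \<nu> where \<nu>: "admissible_cardinal R \<nu>" "leK1 \<in> aec_rels_bounded R \<nu>" "leK2 \<in> aec_rels_bounded R \<nu>"
    using \<kappa> aec_rels_bounded_mono[OF \<kappa>(2,1) _ \<kappa>(3)] aec_rels_bounded_mono[OF \<kappa>(4,3) _ \<kappa>(1)]
    by (elim disjE) simp_all
  have "leK1 \<inter> leK2 \<in> aec_rels_bounded R \<nu>" by (rule aec_rels_bounded_Int[OF uncountable \<nu>])
  with \<nu>(1) show ?thesis by (auto simp: aec_rels_def)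
qed

text \<open>
  The intersection contains \<open>leK\<close>, so it inherits hulls and the direct summand pairs from
  \<open>leK\<close>. The members of \<open>T\<close> may thus have any Loewenheim-Skolem numbers.
\<close>

lemma aec_rels_bounded_Inter:
  fixes leK :: "('r mod_sym, 'u) struct rel" and R :: "('r, 'b) ring_scheme"
  assumes \<kappa>: "admissible_cardinal R \<kappa>" and leK: "leK \<in> aec_rels_bounded R \<kappa>"
    and T: "T \<noteq> {}" "T \<subseteq> aec_rels R" "leK \<subseteq> \<Inter>T"
  shows "\<Inter>T \<in> aec_rels_bounded R \<kappa>"
proof -
  note iff = aec_rels_bounded_iff[OF \<kappa>]
  have LS: "LS_property (mod_lang R) (RMod R) (\<Inter>T) \<kappa>"
    by (rule LS_property_mono_rel[OF _ T(3)]) (use leK in \<open>simp only: iff\<close>)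
  have "AEC (mod_lang R) (RMod R) (\<Inter>T)"
  proof (rule AEC_Inter[OF T(1) _ LS])
    fix leK' assume "leK' \<in> T"
    with T(2) have "leK' \<in> aec_rels R" by (rule subsetD)
    then show "AEC (mod_lang R) (RMod R) leK'" by (simp add: aec_rels_iff)
  qed
  moreover have "\<forall>A B. direct_summand R A B \<longrightarrow> (A, B) \<in> \<Inter>T"
  proof (intro allI impI)
    fix A B :: "('r mod_sym, 'u) struct" assume "direct_summand R A B"
    then have "(A, B) \<in> leK" using leK unfolding iff by blast
    then show "(A, B) \<in> \<Inter>T" by (rule subsetD[OF T(3)])
  qed
  ultimately show ?thesis using LS unfolding iff by blast
qed

lemma aec_rels_bounded_subset: "admissible_cardinal R \<kappa> \<Longrightarrow> aec_rels_bounded R \<kappa> \<subseteq> aec_rels R"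
  by (auto simp: aec_rels_def)

lemma submodule_rel_in_aec_rels_bounded:
  fixes R :: "('r, 'b) ring_scheme" and \<kappa> :: "'u rel"
  assumes "natLeq <o |UNIV :: 'u set|" "regularCard |UNIV :: 'u set|" "ring R"
    and \<kappa>: "admissible_cardinal R \<kappa>"
  shows "submodule_rel R \<in> aec_rels_bounded R \<kappa>"
  unfolding aec_rels_bounded_iff[OF \<kappa>]
proof (intro conjI allI impI)
  show "AEC (mod_lang R) (RMod R) (submodule_rel R :: ('r mod_sym, 'u) struct rel)"
    by (rule AEC_submodule_rel[OF assms])
  show "LS_property (mod_lang R) (RMod R) (submodule_rel R) \<kappa>"
    by (rule LS_property_submodule_rel[OF assms(3) \<kappa>])
  show "(A, B) \<in> submodule_rel R" if "direct_summand R A B" for A and B :: "('r mod_sym, 'u) struct"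
    using that unfolding direct_summand_def by blast
qed

lemma least_reverse_inclusion:
  assumes "leK \<in> S" "\<And>leK'. leK' \<in> S \<Longrightarrow> leK' \<subseteq> leK"
  shows "least (reverse_inclusion S) leK S"
  using assms by (simp add: least_def reverse_inclusion_def)

theorem corollary3p5:
  fixes R :: "('r, 'b) ring_scheme"
  assumes "natLeq <o |UNIV :: 'u set|"
    and "regularCard |UNIV :: 'u set|"
    and "ring R"
    and "|carrier R| <o |UNIV :: 'u set|"
  shows "lattice (reverse_inclusion (aec_rels R :: ('r mod_sym, 'u) struct rel set)) \<and>
         least (reverse_inclusion (aec_rels R)) (submodule_rel R :: ('r mod_sym, 'u) struct rel)
           (aec_rels R) \<and>
         (\<forall>lam :: 'u rel. admissible_cardinal R lam \<longrightarrow>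
            lattice (reverse_inclusion (aec_rels_bounded R lam)) \<and>
            least (reverse_inclusion (aec_rels_bounded R lam)) (submodule_rel R)
              (aec_rels_bounded R lam))"
proof (intro conjI allI impI)
  let ?sub = "submodule_rel R :: ('r mod_sym, 'u) struct rel"
  let ?S = "aec_rels R :: ('r mod_sym, 'u) struct rel set"
  note bottom = submodule_rel_in_aec_rels_bounded[OF assms(1-3)]
  have below: "leK \<subseteq> ?sub" if "leK \<in> ?S" for leK
    using that by (simp add: aec_rels_iff AEC_le_submodule_rel)
  obtain \<kappa>\<^sub>0 :: "'u rel" where \<kappa>0: "admissible_cardinal R \<kappa>\<^sub>0"
    using admissible_cardinal_exists[OF assms(1,4)] by blast
  have sub: "?sub \<in> ?S"
    by (rule subsetD[OF aec_rels_bounded_subset[OF \<kappa>0] bottom[OF \<kappa>0]])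
  show "lattice (reverse_inclusion ?S)"
  proof (rule lattice_reverse_inclusion)
    show "x \<inter> y \<in> ?S" if "x \<in> ?S" "y \<in> ?S" for x y
      using assms(1) that by (rule aec_rels_Int)
    show "\<Inter>{z \<in> ?S. x \<union> y \<subseteq> z} \<in> ?S" if x: "x \<in> ?S" and y: "y \<in> ?S" for x y
    proof -
      obtain \<kappa> where \<kappa>: "admissible_cardinal R \<kappa>" "x \<in> aec_rels_bounded R \<kappa>"
        using x by (auto simp: aec_rels_def)
      \<comment> \<open>the submodule relation is a common lower bound, so the intersection is over a nonempty family\<close>
      have "?sub \<in> {z \<in> ?S. x \<union> y \<subseteq> z}" using sub below[OF x] below[OF y] by simp
      then have ne: "{z \<in> ?S. x \<union> y \<subseteq> z} \<noteq> {}" by (metis empty_iff)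
      have "\<Inter>{z \<in> ?S. x \<union> y \<subseteq> z} \<in> aec_rels_bounded R \<kappa>"
        by (rule aec_rels_bounded_Inter[OF \<kappa> ne]) auto
      then show ?thesis by (rule subsetD[OF aec_rels_bounded_subset[OF \<kappa>(1)]])
    qed
  qed
  show "least (reverse_inclusion ?S) ?sub ?S"
    using sub below by (rule least_reverse_inclusion)
  fix lam :: "'u rel" assume lam: "admissible_cardinal R lam"
  let ?B = "aec_rels_bounded R lam :: ('r mod_sym, 'u) struct rel set"
  note B = aec_rels_bounded_subset[OF lam]
  show "lattice (reverse_inclusion ?B)"
  proof (rule lattice_reverse_inclusion)
    show "x \<inter> y \<in> ?B" if "x \<in> ?B" "y \<in> ?B" for x y
      using assms(1) lam that by (rule aec_rels_bounded_Int)
    show "\<Inter>{z \<in> ?B. x \<union> y \<subseteq> z} \<in> ?B" if x: "x \<in> ?B" and y: "y \<in> ?B" for x y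
    proof -
      have "x \<in> ?S" "y \<in> ?S" using x y B by blast+
      then have "?sub \<in> {z \<in> ?B. x \<union> y \<subseteq> z}" using bottom[OF lam] below by simp
      then have ne: "{z \<in> ?B. x \<union> y \<subseteq> z} \<noteq> {}" by (metis empty_iff)
      show ?thesis
        by (rule aec_rels_bounded_Inter[OF lam x ne]) (use B in auto)
    qed
  qed
  show "least (reverse_inclusion ?B) ?sub ?B"
    using bottom[OF lam] below[OF subsetD[OF B]] by (rule least_reverse_inclusion)
qed

end
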